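(* Let $2\le n<\infty$, $p\in\mathbb{N}$ and $A_1,\dots,A_n\in M_p$. The element \[I_p\otimes\delta_0+\sum_{i=1}^nA_i\otimes\delta_i+\sum_{i=1}^nA_i^*\otimes\delta_i^*\in M_p(\mathcal{S}_n^d)\] is positive if and only if $(A_1,\dots,A_n)$ is a row contraction, i.e. $\sum_{i=1}^nA_iA_i^*\le I_p$.
   Context: $\mathcal{O}_n$ is the Cuntz algebra, generated by isometries $S_1,\dots,S_n$ with $\sum_{i=1}^n S_iS_i^*=I$; $\mathcal{S}_n=\operatorname{span}\{I,S_1,\dots,S_n,S_1^*,\dots,S_n^*\}$, with basis $I,S_i,S_i^*$. $\mathcal{S}_n^d$ is the dual space of $\mathcal{S}_n$ with dual basis $\delta_0,\delta_i,\delta_i^*$ ($1\le i\le n$): $\delta_0(I)=1$, $\delta_0(S_j)=\delta_0(S_j^* )=0$; $\delta_i(I)=0$, $\delta_i(S_j)=\delta_{ij}$, $\delta_i(S_j^* )=0$; $\delta_i^*(I)=0$, $\delta_i^*(S_j^* )=\delta_{ij}$, $\delta_i^*(S_j)=0$, where $\delta_{ij}$ is the Kronecker delta. For $A=(a_{kl})\in M_p$ and $f\in\mathcal{S}_n^d$, $A\otimes f$ denotes $(a_{kl}f)\in M_p(\mathcal{S}_n^d)$. The matrix order on $\mathcal{S}_n^d$ is: $(f_{kl})\in M_p(\mathcal{S}_n^d)^+$ iff the map $\mathcal{S}_n\to M_p$, $x\mapsto(f_{kl}(x))$, is completely positive. *)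

theory Defs
  imports
    Complex_Main
    "HOL-Library.Function_Algebras"
    "Jordan_Normal_Form.Matrix"
    "Jordan_Normal_Form.Schur_Decomposition"
begin

section \<open>Unital C*-algebras\<close>

text \<open>The real structure (norm, topology, real scalar multiplication) is inherited from the library
  classes; since \<open>norm 1 = 1\<close> there, the zero algebra is excluded.\<close>

class cstar_algebra = real_normed_algebra_1 + complete_space +
  fixes scaleC :: "complex \<Rightarrow> 'a \<Rightarrow> 'a"  (infixr \<open>*\<^sub>C\<close> 75)
    and star :: "'a \<Rightarrow> 'a"
  assumes scaleC_add_right: "a *\<^sub>C (x + y) = a *\<^sub>C x + a *\<^sub>C y"
    and scaleC_add_left: "(a + b) *\<^sub>C x = a *\<^sub>C x + b *\<^sub>C x"
    and scaleC_scaleC: "a *\<^sub>C (b *\<^sub>C x) = (a * b) *\<^sub>C x"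
    and scaleC_of_real: "complex_of_real r *\<^sub>C x = r *\<^sub>R x"
    and mult_scaleC_left: "(a *\<^sub>C x) * y = a *\<^sub>C (x * y)"
    and mult_scaleC_right: "x * (a *\<^sub>C y) = a *\<^sub>C (x * y)"
    and norm_scaleC: "norm (a *\<^sub>C x) = cmod a * norm x"
    and star_star: "star (star x) = x"
    and star_add: "star (x + y) = star x + star y"
    and star_scaleC: "star (a *\<^sub>C x) = cnj a *\<^sub>C star x"
    and star_mult: "star (x * y) = star y * star x"
    and cstar_identity: "norm (star x * x) = (norm x)\<^sup>2"

lemma scaleC_one: "1 *\<^sub>C (x :: 'a :: cstar_algebra) = x"
  using scaleC_of_real[of 1 x] by simp

global_interpretation complex_vs: vector_space "scaleC :: complex \<Rightarrow> 'a \<Rightarrow> 'a :: cstar_algebra"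
  by unfold_locales (rule scaleC_add_right scaleC_add_left scaleC_scaleC scaleC_one)+

definition cstar_subalgebra :: "'a :: cstar_algebra set \<Rightarrow> bool" where
  "cstar_subalgebra B \<longleftrightarrow> closed B \<and> 1 \<in> B \<and>
     (\<forall>x\<in>B. \<forall>y\<in>B. x + y \<in> B \<and> x * y \<in> B) \<and> (\<forall>c. \<forall>x\<in>B. c *\<^sub>C x \<in> B) \<and> (\<forall>x\<in>B. star x \<in> B)"

definition cstar_generated :: "'a :: cstar_algebra set \<Rightarrow> 'a set" where
  "cstar_generated X = \<Inter>{B. cstar_subalgebra B \<and> X \<subseteq> B}"


section \<open>The Cuntz algebra and its generating operator system\<close>

text \<open>\<open>cuntz_algebra n S\<close>: the whole type \<^typ>\<open>'a\<close> is the Cuntz algebra on \<open>n\<close> generators, with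
  canonical generators \<open>S 1, \<dots>, S n\<close>. By the uniqueness theorem of Cuntz, for \<open>n \<ge> 2\<close> these
  conditions determine the algebra together with its generators up to isomorphism.\<close>

definition cuntz_algebra :: "nat \<Rightarrow> (nat \<Rightarrow> 'a :: cstar_algebra) \<Rightarrow> bool" where
  "cuntz_algebra n S \<longleftrightarrow>
     (\<forall>i\<in>{1..n}. star (S i) * S i = 1) \<and>
     (\<Sum>i=1..n. S i * star (S i)) = 1 \<and>
     cstar_generated (S ` {1..n}) = UNIV"

definition cuntz_basis :: "nat \<Rightarrow> (nat \<Rightarrow> 'a :: cstar_algebra) \<Rightarrow> 'a set" where
  "cuntz_basis n S = {1} \<union> S ` {1..n} \<union> (\<lambda>i. star (S i)) ` {1..n}"

definition cuntz_system :: "nat \<Rightarrow> (nat \<Rightarrow> 'a :: cstar_algebra) \<Rightarrow> 'a set" where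
  "cuntz_system n S = complex_vs.span (cuntz_basis n S)"


section \<open>Matrix order and complete positivity\<close>

definition star_mat :: "'a :: cstar_algebra mat \<Rightarrow> 'a mat" where
  "star_mat X = mat (dim_col X) (dim_row X) (\<lambda>(i, j). star (X $$ (j, i)))"

text \<open>The cone \<open>M\<^sub>m(V)\<^sup>+\<close> for a subspace \<open>V\<close> of a C*-algebra: those matrices over \<open>V\<close> that are
  positive elements of the C*-algebra of \<open>m \<times> m\<close> matrices over the ambient algebra.\<close>

definition matrix_cone :: "'a :: cstar_algebra set \<Rightarrow> nat \<Rightarrow> 'a mat set" where
  "matrix_cone V m = {X \<in> carrier_mat m m. (\<forall>i<m. \<forall>j<m. X $$ (i, j) \<in> V) \<and>
     (\<exists>Y \<in> carrier_mat m m. X = star_mat Y * Y)}"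

text \<open>Below, \<open>\<le>\<close> on \<^typ>\<open>complex\<close> is the order of \<open>HOL-Library.Complex_Order\<close>, so that
  \<open>0 \<le> z\<close> says that \<open>z\<close> is real and nonnegative.\<close>

definition psd :: "nat \<Rightarrow> complex mat \<Rightarrow> bool" where
  "psd p A \<longleftrightarrow> A \<in> carrier_mat p p \<and> (\<forall>v \<in> carrier_vec p. 0 \<le> (A *\<^sub>v v) \<bullet>c v)"

definition loewner_le :: "nat \<Rightarrow> complex mat \<Rightarrow> complex mat \<Rightarrow> bool" where
  "loewner_le p A B \<longleftrightarrow> A \<in> carrier_mat p p \<and> B \<in> carrier_mat p p \<and> psd p (B - A)"

text \<open>The \<open>m\<close>-th amplification of \<open>\<Phi> : V \<rightarrow> M\<^sub>p\<close>, with values in \<open>M\<^sub>m(M\<^sub>p) = M\<^bsub>m p\<^esub>\<close>: the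
  \<open>p \<times> p\<close> block in position \<open>(i, j)\<close> is \<open>\<Phi> (X\<^bsub>i j\<^esub>)\<close>.\<close>

definition amplify :: "nat \<Rightarrow> ('a \<Rightarrow> complex mat) \<Rightarrow> nat \<Rightarrow> 'a mat \<Rightarrow> complex mat" where
  "amplify p \<Phi> m X =
     mat (m * p) (m * p) (\<lambda>(r, s). \<Phi> (X $$ (r div p, s div p)) $$ (r mod p, s mod p))"

definition completely_positive ::
  "'a :: cstar_algebra set \<Rightarrow> nat \<Rightarrow> ('a \<Rightarrow> complex mat) \<Rightarrow> bool" where
  "completely_positive V p \<Phi> \<longleftrightarrow>
     (\<forall>x\<in>V. \<Phi> x \<in> carrier_mat p p) \<and>
     (\<forall>x\<in>V. \<forall>y\<in>V. \<Phi> (x + y) = \<Phi> x + \<Phi> y) \<and>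
     (\<forall>c. \<forall>x\<in>V. \<Phi> (c *\<^sub>C x) = c \<cdot>\<^sub>m \<Phi> x) \<and>
     (\<forall>m. \<forall>X \<in> matrix_cone V m. psd (m * p) (amplify p \<Phi> m X))"


section \<open>The matrix-ordered dual\<close>

text \<open>Functionals on \<open>V\<close> are represented by functions on the ambient type that vanish off \<open>V\<close>.
  All uses have \<open>V\<close> finite-dimensional, where linear functionals are automatically bounded.\<close>

definition dual_space :: "'a :: cstar_algebra set \<Rightarrow> ('a \<Rightarrow> complex) set" where
  "dual_space V = {f. (\<forall>x\<in>V. \<forall>y\<in>V. f (x + y) = f x + f y) \<and>
     (\<forall>c. \<forall>x\<in>V. f (c *\<^sub>C x) = c * f x) \<and> (\<forall>x. x \<notin> V \<longrightarrow> f x = 0)}"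

definition dual_matrix_cone :: "'a :: cstar_algebra set \<Rightarrow> nat \<Rightarrow> ('a \<Rightarrow> complex) mat set" where
  "dual_matrix_cone V p = {F \<in> carrier_mat p p. (\<forall>k<p. \<forall>l<p. F $$ (k, l) \<in> dual_space V) \<and>
     completely_positive V p (\<lambda>x. map_mat (\<lambda>f. f x) F)}"

text \<open>The dual basis: \<open>cuntz_delta n S b\<close> sends an element of \<open>cuntz_system n S\<close> to its coefficient
  at the basis vector \<open>b\<close>. That \<open>cuntz_basis n S\<close> is a basis, and the resulting values of the
  functionals on it, are proved at the end of this theory.\<close>

definition cuntz_delta :: "nat \<Rightarrow> (nat \<Rightarrow> 'a :: cstar_algebra) \<Rightarrow> 'a \<Rightarrow> 'a \<Rightarrow> complex" where
  "cuntz_delta n S b = (\<lambda>x. complex_vs.representation (cuntz_basis n S) x b)"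

definition delta0 :: "nat \<Rightarrow> (nat \<Rightarrow> 'a :: cstar_algebra) \<Rightarrow> 'a \<Rightarrow> complex" where
  "delta0 n S = cuntz_delta n S 1"

definition delta :: "nat \<Rightarrow> (nat \<Rightarrow> 'a :: cstar_algebra) \<Rightarrow> nat \<Rightarrow> 'a \<Rightarrow> complex" where
  "delta n S i = cuntz_delta n S (S i)"

definition delta_star :: "nat \<Rightarrow> (nat \<Rightarrow> 'a :: cstar_algebra) \<Rightarrow> nat \<Rightarrow> 'a \<Rightarrow> complex" where
  "delta_star n S i = cuntz_delta n S (star (S i))"

definition tensor :: "complex mat \<Rightarrow> ('a \<Rightarrow> complex) \<Rightarrow> ('a \<Rightarrow> complex) mat"  (infixl \<open>\<otimes>\<^sub>f\<close> 70) where
  "A \<otimes>\<^sub>f f = map_mat (\<lambda>a x. a * f x) A"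

text \<open>Matrices of unspecified dimension form no monoid, so \<^const>\<open>sum\<close> does not apply to them.\<close>

definition mat_sum :: "nat \<Rightarrow> 'i set \<Rightarrow> ('i \<Rightarrow> 'b :: comm_monoid_add mat) \<Rightarrow> 'b mat" where
  "mat_sum p I F = mat p p (\<lambda>(k, l). \<Sum>i\<in>I. F i $$ (k, l))"

definition row_contraction :: "nat \<Rightarrow> nat \<Rightarrow> (nat \<Rightarrow> complex mat) \<Rightarrow> bool" where
  "row_contraction p n A \<longleftrightarrow> loewner_le p (mat_sum p {1..n} (\<lambda>i. A i * mat_adjoint (A i))) (1\<^sub>m p)"


section \<open>The dual basis\<close>

lemma star_zero [simp]: "star (0 :: 'a :: cstar_algebra) = 0"
  using star_add[of "0::'a" 0] by simp

lemma star_one [simp]: "star (1 :: 'a :: cstar_algebra) = 1"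
  by (metis mult.left_neutral mult.right_neutral star_mult star_star)

lemma star_sum: "star (sum f I) = (\<Sum>i\<in>I. star (f i :: 'a :: cstar_algebra))"
  by (induction I rule: infinite_finite_induct) (auto simp: star_add)

lemma star_minus [simp]: "star (- x) = - star (x :: 'a :: cstar_algebra)"
  by (metis add.inverse_unique add.right_inverse star_add star_zero)

lemma star_diff: "star (x - y) = star x - star (y :: 'a :: cstar_algebra)"
  using star_add[of x "- y"] by simp

lemma norm_star [simp]: "norm (star x) = norm (x :: 'a :: cstar_algebra)"
proof -
  have le: "norm y \<le> norm (star y)" for y :: 'a
  proof (cases "norm y = 0")
    case False
    have "norm y * norm y \<le> norm (star y) * norm y"
      using norm_mult_ineq[of "star y" y] cstar_identity[of y] by (simp add: power2_eq_square)
    with False show ?thesis by simp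
  qed simp
  from le[of x] le[of "star x"] show ?thesis by (simp add: star_star)
qed

lemma scaleC_power: "(z *\<^sub>C x) ^ j = z ^ j *\<^sub>C (x :: 'a :: cstar_algebra) ^ j"
  by (induction j) (simp_all add: scaleC_one mult_scaleC_left mult_scaleC_right scaleC_scaleC mult_ac)

lemma power_expansion:
  fixes x :: "'a :: cstar_algebra"
  shows "\<exists>c. (m > 0 \<longrightarrow> c 1 = of_nat m *\<^sub>C x) \<and> c 0 = 1 \<and> (\<forall>j>m. c j = 0) \<and>
           (\<forall>z. (1 + z *\<^sub>C x) ^ m = (\<Sum>j\<le>m. z ^ j *\<^sub>C c j))"
proof (induction m)
  case 0
  show ?case by (rule exI[of _ "\<lambda>j. if j = 0 then 1 else 0"]) (simp add: scaleC_one)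
next
  case (Suc m)
  then obtain c where c1: "m > 0 \<longrightarrow> c 1 = of_nat m *\<^sub>C x" and c0: "c 0 = 1"
    and cz: "\<forall>j>m. c j = 0" and c: "\<And>z. (1 + z *\<^sub>C x) ^ m = (\<Sum>j\<le>m. z ^ j *\<^sub>C c j)"
    by blast
  define d where "d j = c j + (case j of 0 \<Rightarrow> 0 | Suc i \<Rightarrow> x * c i)" for j
  have "d 1 = of_nat (Suc m) *\<^sub>C x"
    using c1 c0 cz by (cases "m = 0") (simp_all add: d_def scaleC_add_left scaleC_one add.commute)
  moreover have "d 0 = 1" using c0 by (simp add: d_def)
  moreover have "\<forall>j>Suc m. d j = 0" using cz by (auto simp: d_def split: nat.splits)
  moreover have "(1 + z *\<^sub>C x) ^ Suc m = (\<Sum>j\<le>Suc m. z ^ j *\<^sub>C d j)" for z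
  proof -
    have "(1 + z *\<^sub>C x) ^ Suc m = (\<Sum>j\<le>m. z ^ j *\<^sub>C c j) + (\<Sum>j\<le>m. z ^ Suc j *\<^sub>C (x * c j))"
    proof -
      have "(1 + z *\<^sub>C x) ^ Suc m = (1 + z *\<^sub>C x) * (\<Sum>j\<le>m. z ^ j *\<^sub>C c j)" by (simp add: c)
      also have "\<dots> = (\<Sum>j\<le>m. z ^ j *\<^sub>C c j) + (\<Sum>j\<le>m. (z *\<^sub>C x) * (z ^ j *\<^sub>C c j))"
        by (simp only: distrib_right mult_1_left sum_distrib_left sum.distrib)
      finally show ?thesis
        by (simp add: mult_scaleC_left mult_scaleC_right scaleC_scaleC mult.commute[of z])
    qed
    also have "(\<Sum>j\<le>m. z ^ j *\<^sub>C c j) = (\<Sum>j\<le>Suc m. z ^ j *\<^sub>C c j)" using cz by simp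
    also have "(\<Sum>j\<le>m. z ^ Suc j *\<^sub>C (x * c j))
        = (\<Sum>j\<le>Suc m. z ^ j *\<^sub>C (case j of 0 \<Rightarrow> 0 | Suc i \<Rightarrow> x * c i))"
      by (subst sum.atMost_Suc_shift) simp
    finally show ?thesis unfolding d_def by (simp only: scaleC_add_right sum.distrib)
  qed
  ultimately show ?case by blast
qed

lemma sum_root_of_unity:
  fixes m j :: nat
  assumes "j \<le> m" "m \<ge> 1"
  defines "\<omega> \<equiv> cis (2 * pi / of_nat (Suc m))"
  shows "(\<Sum>k<Suc m. (\<omega> ^ k) ^ (m + j)) = (if j = 1 then of_nat (Suc m) else 0)"
proof -
  have 1: "\<omega> ^ Suc m = 1"
    unfolding \<omega>_def by (subst DeMoivre) (simp add: cis_2pi del: of_nat_Suc)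
  have eq: "(\<Sum>k<Suc m. (\<omega> ^ k) ^ (m + j)) = (\<Sum>k<Suc m. (\<omega> ^ (m + j)) ^ k)"
    by (metis (no_types, lifting) mult.commute power_mult)
  show ?thesis
  proof (cases "j = 1")
    case True
    with 1 show ?thesis unfolding eq by (simp del: of_nat_Suc sum.lessThan_Suc power_Suc)
  next
    case False
    have ne: "\<omega> ^ (m + j) \<noteq> 1"
    proof
      assume "\<omega> ^ (m + j) = 1"
      then have "cos (of_nat (m + j) * (2 * pi / of_nat (Suc m))) = 1"
        unfolding \<omega>_def DeMoivre by (metis cis.sel(1) one_complex.sel(1))
      then obtain q :: int where "of_nat (m + j) * (2 * pi / of_nat (Suc m)) = of_int q * 2 * pi"
        using cos_one_2pi_int by blast
      then have "of_nat (m + j) = of_int q * (of_nat (Suc m) :: real)"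
      proof -
        assume "of_nat (m + j) * (2 * pi / of_nat (Suc m)) = of_int q * 2 * pi"
        then have "2 * pi * of_nat (m + j) = 2 * pi * (of_int q * of_nat (Suc m))"
          by (simp add: field_simps del: of_nat_Suc of_nat_add)
        then show ?thesis by (simp only: mult_cancel_left) simp
      qed
      then have q: "int (m + j) = q * int (Suc m)" by (metis of_int_eq_iff of_int_mult of_int_of_nat_eq)
      then have "int (Suc m) dvd int (m + j)" by simp
      then have "Suc m dvd m + j" by (simp only: int_dvd_int_iff)
      then obtain r where r: "m + j = Suc m * r" by (elim dvdE)
      have "r < 2"
      proof (rule ccontr)
        assume "\<not> r < 2"
        then have "Suc m * 2 \<le> Suc m * r" by (intro mult_le_mono) auto
        with r assms(1) show False by simp
      qed
      with r assms False show False by (cases r) auto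
    qed
    have "(\<omega> ^ (m + j)) ^ Suc m = 1" by (metis 1 mult.commute power_mult power_one)
    with ne False show ?thesis unfolding eq by (simp add: geometric_sum del: power_Suc sum.lessThan_Suc)
  qed
qed

text \<open>The unit is an extreme point of the unit ball, in the selfadjoint case. It replaces the
  positivity argument in the proof that the ranges of the \<open>S i\<close> are orthogonal.\<close>

lemma selfadjoint_extreme:
  fixes x :: "'a :: cstar_algebra"
  assumes sa: "star x = x" and p: "norm (1 + x) \<le> 1" and q: "norm (1 - x) \<le> 1"
  shows "x = 0"
proof (rule ccontr)
  assume "x \<noteq> 0"
  define r where "r = norm x"
  have r: "r > 0" using \<open>x \<noteq> 0\<close> by (simp add: r_def)
  have real: "norm (1 + t *\<^sub>R x) \<le> 1" if "\<bar>t\<bar> \<le> 1" for t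
  proof -
    have "1 + t *\<^sub>R x = ((1 + t) / 2) *\<^sub>R (1 + x) + ((1 - t) / 2) *\<^sub>R (1 - x)"
      by (simp add: algebra_simps flip: scaleR_add_left) (simp add: field_simps flip: scaleR_add_left)
    also have "norm \<dots> \<le> ((1 + t) / 2) * norm (1 + x) + ((1 - t) / 2) * norm (1 - x)"
      using that by (intro order_trans[OF norm_triangle_ineq]) auto
    also have "\<dots> \<le> ((1 + t) / 2) * 1 + ((1 - t) / 2) * 1"
      using that p q by (intro add_mono mult_left_mono) auto
    finally show ?thesis by (simp add: field_simps)
  qed
  have cpx: "(norm (1 + w *\<^sub>C x))\<^sup>2 \<le> 1 + (cmod w)\<^sup>2 * r\<^sup>2" if "\<bar>Re w\<bar> \<le> 1 / 2" for w
  proof -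
    have "star (1 + w *\<^sub>C x) * (1 + w *\<^sub>C x)
        = 1 + (w + cnj w) *\<^sub>C x + (cnj w * w) *\<^sub>C (x * x)"
      by (simp add: star_add star_scaleC sa algebra_simps mult_scaleC_left mult_scaleC_right
            scaleC_scaleC scaleC_add_left)
    also have "(w + cnj w) *\<^sub>C x = (2 * Re w) *\<^sub>R x"
      by (simp only: complex_add_cnj scaleC_of_real)
    finally have "(norm (1 + w *\<^sub>C x))\<^sup>2 = norm (1 + (2 * Re w) *\<^sub>R x + (cnj w * w) *\<^sub>C (x * x))"
      by (metis cstar_identity)
    also have "\<dots> \<le> 1 + (cmod w)\<^sup>2 * norm (x * x)"
    proof -
      have "norm (1 + (2 * Re w) *\<^sub>R x) \<le> 1" using that by (intro real) auto
      moreover have "norm ((cnj w * w) *\<^sub>C (x * x)) = (cmod w)\<^sup>2 * norm (x * x)"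
        by (simp add: norm_scaleC norm_mult power2_eq_square)
      ultimately show ?thesis
        by (intro order_trans[OF norm_triangle_ineq]) simp
    qed
    also have "norm (x * x) = r\<^sup>2" using cstar_identity[of x] by (simp add: sa r_def)
    finally show ?thesis .
  qed
  obtain m :: nat where m: "real m \<ge> max 16 (8 / r)" using real_arch_simple by blast
  have m16: "real m \<ge> 16" and m8: "8 / r \<le> real m" and m1: "m \<ge> 1" using m by auto
  obtain c where c1: "c 1 = of_nat m *\<^sub>C x"
    and c: "\<And>z. (1 + z *\<^sub>C x) ^ m = (\<Sum>j\<le>m. z ^ j *\<^sub>C c j)"
    using power_expansion[of m x] m1 by auto
  define \<omega> where "\<omega> = cis (2 * pi / of_nat (Suc m))"
  define w where "w = 4 / (r * real m)"
  have w0: "w > 0" and w2: "w \<le> 1 / 2" using r m8 m1 by (auto simp: w_def field_simps)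
  have wr: "w\<^sup>2 * r\<^sup>2 = 16 / (real m)\<^sup>2" using r by (simp add: w_def power_divide power_mult_distrib)
  have w\<omega>: "cmod (of_real w * \<omega> ^ k) = w" for k
    using w0 by (simp add: norm_mult norm_power \<omega>_def)
  have "(\<Sum>k<Suc m. (\<omega> ^ k) ^ m *\<^sub>C (1 + (of_real w * \<omega> ^ k) *\<^sub>C x) ^ m)
      = (\<Sum>k<Suc m. \<Sum>j\<le>m. (of_real w ^ j * (\<omega> ^ k) ^ (m + j)) *\<^sub>C c j)"
    by (simp add: c complex_vs.scale_sum_right scaleC_scaleC power_mult_distrib power_add mult_ac
          del: sum.lessThan_Suc)
  also have "\<dots> = (\<Sum>j\<le>m. (of_real w ^ j * (\<Sum>k<Suc m. (\<omega> ^ k) ^ (m + j))) *\<^sub>C c j)"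
    by (subst sum.swap) (simp add: complex_vs.scale_sum_left sum_distrib_left del: sum.lessThan_Suc)
  also have "\<dots> = (\<Sum>j\<le>m. if j = 1 then (of_real w * of_nat (Suc m)) *\<^sub>C c 1 else 0)"
  proof (rule sum.cong[OF refl])
    fix j assume "j \<in> {..m}"
    then have "(\<Sum>k<Suc m. (\<omega> ^ k) ^ (m + j)) = (if j = 1 then of_nat (Suc m) else 0)"
      unfolding \<omega>_def using m1 by (intro sum_root_of_unity) auto
    then show "(of_real w ^ j * (\<Sum>k<Suc m. (\<omega> ^ k) ^ (m + j))) *\<^sub>C c j
        = (if j = 1 then (of_real w * of_nat (Suc m)) *\<^sub>C c 1 else 0)"
      by (simp only:) simp
  qed
  also have "\<dots> = (of_real w * of_nat (Suc m)) *\<^sub>C c 1" using m1 by simp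
  also have "norm \<dots> = real (Suc m) * (w * real m * r)"
    using w0 unfolding c1 by (simp add: norm_scaleC norm_mult r_def del: of_nat_Suc)
  also have "w * real m * r = 4" using r m1 by (simp add: w_def)
  finally have "real (Suc m) * 4
      = norm (\<Sum>k<Suc m. (\<omega> ^ k) ^ m *\<^sub>C (1 + (of_real w * \<omega> ^ k) *\<^sub>C x) ^ m)" by simp
  also have "\<dots> \<le> (\<Sum>k<Suc m. norm ((\<omega> ^ k) ^ m *\<^sub>C (1 + (of_real w * \<omega> ^ k) *\<^sub>C x) ^ m))"
    by (rule norm_sum)
  also have "\<dots> \<le> (\<Sum>k<Suc m. 2)"
  proof (rule sum_mono)
    fix k
    let ?u = "1 + (of_real w * \<omega> ^ k) *\<^sub>C x"
    have "\<bar>Re (of_real w * \<omega> ^ k)\<bar> \<le> 1 / 2" using abs_Re_le_cmod w\<omega>[of k] w2 by (metis order_trans)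
    then have "(norm ?u)\<^sup>2 \<le> 1 + 16 / (real m)\<^sup>2" using cpx w\<omega> wr by metis
    also have "\<dots> \<le> 1 + 1 / real m" using m16 by (simp add: field_simps power2_eq_square)
    also have "\<dots> \<le> exp (1 / real m)" by (rule exp_ge_add_one_self)
    finally have "((norm ?u)\<^sup>2) ^ m \<le> exp (1 / real m) ^ m" by (intro power_mono) auto
    also have "\<dots> = exp 1" using m1 by (simp flip: exp_of_nat_mult)
    also have "\<dots> \<le> 2\<^sup>2" using exp_le by simp
    finally have "(norm ?u ^ m)\<^sup>2 \<le> 2\<^sup>2" by (simp add: power_mult[symmetric] mult.commute)
    then have "norm ?u ^ m \<le> 2" by (rule power2_le_imp_le) simp
    with norm_power_ineq[of ?u m] have "norm (?u ^ m) \<le> 2" by simp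
    then show "norm ((\<omega> ^ k) ^ m *\<^sub>C ?u ^ m) \<le> 2" by (simp add: norm_scaleC norm_power \<omega>_def)
  qed
  finally show False by simp
qed

lemma cuntz_orth:
  assumes C: "cuntz_algebra n S" and i: "i \<in> {1..n}" and j: "j \<in> {1..n}" and ne: "i \<noteq> j"
  shows "star (S i) * S j = 0"
proof -
  have iso: "star (S k) * S k = 1" if "k \<in> {1..n}" for k
    using C that by (auto simp: cuntz_algebra_def)
  have nS: "norm (S j) = 1"
    using cstar_identity[of "S j"] iso[OF j] norm_ge_zero[of "S j"] by (simp add: power2_eq_1_iff)
  define T where "T k = star (S j) * (S k * star (S k)) * S j" for k
  define K where "K = {1..n} - {i, j}"
  have T: "norm (1 - 2 *\<^sub>R T k) \<le> 1" if k: "k \<in> {1..n}" for k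
  proof -
    define P where "P = S k * star (S k)"
    have PP: "P * P = P"
      unfolding P_def by (metis iso[OF k] mult.assoc mult.right_neutral)
    have sP: "star P = P" by (simp add: P_def star_mult star_star)
    have s2: "star (2 *\<^sub>R P) = 2 *\<^sub>R P"
      using sP by (simp add: scaleR_2 star_add)
    have "star (1 - 2 *\<^sub>R P) * (1 - 2 *\<^sub>R P) = 1"
      by (simp add: star_diff s2 algebra_simps PP) (simp flip: scaleR_add_left)
    then have U: "norm (1 - 2 *\<^sub>R P) = 1"
      using cstar_identity[of "1 - 2 *\<^sub>R P"] norm_ge_zero[of "1 - 2 *\<^sub>R P"]
      by (simp add: power2_eq_1_iff)
    have "1 - 2 *\<^sub>R T k = star (S j) * (1 - 2 *\<^sub>R P) * S j"
      by (simp add: T_def P_def algebra_simps iso[OF j])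
    also have "norm \<dots> \<le> norm (star (S j)) * norm (1 - 2 *\<^sub>R P) * norm (S j)"
      by (meson mult_right_mono norm_ge_zero norm_mult_ineq order_trans)
    finally show ?thesis by (simp add: nS U)
  qed
  have "(\<Sum>k\<in>{1..n}. T k) = star (S j) * (\<Sum>k=1..n. S k * star (S k)) * S j"
    by (simp add: T_def sum_distrib_left sum_distrib_right)
  also have "\<dots> = 1" using C iso[OF j] by (simp add: cuntz_algebra_def)
  finally have "(\<Sum>k\<in>{1..n}. T k) = 1" .
  moreover have "{1..n} = insert i (insert j K)" "i \<notin> insert j K" "j \<notin> K" "finite K"
    using i j ne by (auto simp: K_def)
  moreover have "T j = 1" by (simp add: T_def mult.assoc iso[OF j])
  ultimately have sum0: "T i + (\<Sum>k\<in>K. T k) = 0" by simp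
  have Ti: "T i = 0"
  proof (cases "K = {}")
    case True
    with sum0 show ?thesis by simp
  next
    case False
    define N where "N = real (card K)"
    have N: "N \<ge> 1" using False \<open>finite K\<close> by (simp add: N_def Suc_le_eq card_gt_0_iff)
    define x where "x = (2 / N) *\<^sub>R T i"
    have "N *\<^sub>R (1 + x) = (\<Sum>k\<in>K. 1 - 2 *\<^sub>R T k)"
    proof -
      have "(\<Sum>k\<in>K. T k) = - T i" using sum0 by (simp add: eq_neg_iff_add_eq_0 add.commute)
      then have "(\<Sum>k\<in>K. 1 - 2 *\<^sub>R T k) = N *\<^sub>R 1 + 2 *\<^sub>R T i"
        by (simp add: sum_subtractf scaleR_sum_right[symmetric] N_def scaleR_conv_of_real
            flip: sum_distrib_left)
      also have "\<dots> = N *\<^sub>R (1 + x)" using N by (simp add: x_def scaleR_add_right)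
      finally show ?thesis by simp
    qed
    also have "norm \<dots> \<le> (\<Sum>k\<in>K. 1)"
      by (rule order_trans[OF norm_sum], rule sum_mono) (auto intro: T simp: K_def)
    finally have 1: "norm (1 + x) \<le> 1" using N by (simp add: N_def)
    have "1 - x = (1 - 1 / N) *\<^sub>R 1 + (1 / N) *\<^sub>R (1 - 2 *\<^sub>R T i)"
      by (simp add: x_def algebra_simps)
    also have "norm \<dots> \<le> norm ((1 - 1 / N) *\<^sub>R (1 :: 'a)) + norm ((1 / N) *\<^sub>R (1 - 2 *\<^sub>R T i))"
      by (rule norm_triangle_ineq)
    also have "\<dots> = (1 - 1 / N) + (1 / N) * norm (1 - 2 *\<^sub>R T i)"
      using N by simp
    also have "\<dots> \<le> (1 - 1 / N) + (1 / N) * 1"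
      using N T[OF i] by (intro add_mono mult_left_mono) auto
    finally have 2: "norm (1 - x) \<le> 1" by simp
    have "star x = x"
      by (simp add: x_def T_def scaleC_of_real[symmetric] star_scaleC star_mult star_star mult.assoc del: of_real_divide)
    from selfadjoint_extreme[OF this 1 2] show ?thesis using N by (simp add: x_def)
  qed
  have "(norm (star (S i) * S j))\<^sup>2 = norm (T i)"
    by (simp add: T_def cstar_identity[symmetric] star_mult star_star mult.assoc)
  with Ti show ?thesis by simp
qed

context
  fixes n :: nat and S :: "nat \<Rightarrow> 'a :: cstar_algebra"
  assumes n: "2 \<le> n" and C: "cuntz_algebra n S"
begin

lemma cuntz_star_mult:
  assumes "i \<in> {1..n}" "j \<in> {1..n}"
  shows "star (S i) * S j = (if i = j then 1 else 0)"
  using cuntz_orth[OF C assms] C assms by (auto simp: cuntz_algebra_def)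

lemma cuntz_star_mult_left:
  assumes "i \<in> {1..n}" "j \<in> {1..n}"
  shows "star (S i) * (S j * x) = (if i = j then x else 0)"
  using cuntz_star_mult[OF assms] by (simp flip: mult.assoc)

lemma cuntz_coefficients:
  assumes "a *\<^sub>C 1 + (\<Sum>i=1..n. b i *\<^sub>C S i) + (\<Sum>i=1..n. c i *\<^sub>C star (S i)) = 0"
  shows "a = 0" and "\<forall>j\<in>{1..n}. b j = 0" and "\<forall>j\<in>{1..n}. c j = 0"
proof -
  define G where "G = S 1 * S 1 * S 2"
  have 12: "1 \<in> {1..n}" "2 \<in> {1..n}" using n by auto
  note rel = cuntz_star_mult cuntz_star_mult_left
  have GG: "star G * G = 1"
    using 12 by (simp add: G_def star_mult mult.assoc rel)
  have G1: "star G * (S i * G) = 0" if "i \<in> {1..n}" for i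
    using 12 that by (auto simp: G_def star_mult mult.assoc rel)
  have G2: "star G * (S i * (S j * G)) = 0" if "i \<in> {1..n}" "j \<in> {1..n}" for i j
    using 12 that by (auto simp: G_def star_mult mult.assoc rel)
  have G1': "star G * (star (S i) * G) = 0" if "i \<in> {1..n}" for i
    using arg_cong[OF G1[OF that], of star] by (simp add: star_mult star_star mult.assoc)
  have G2': "star G * (star (S j) * (star (S i) * G)) = 0" if "i \<in> {1..n}" "j \<in> {1..n}" for i j
    using arg_cong[OF G2[OF that], of star] by (simp add: star_mult star_star mult.assoc)
  have scal: "z = 0" if "z *\<^sub>C (1 :: 'a) = 0" for z
    using that by (metis complex_vs.scale_eq_0_iff zero_neq_one)
  have "0 = star G * ((a *\<^sub>C 1 + (\<Sum>i=1..n. b i *\<^sub>C S i) + (\<Sum>i=1..n. c i *\<^sub>C star (S i))) * G)"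
    using assms by simp
  also have "\<dots> = a *\<^sub>C 1"
    by (simp add: distrib_left distrib_right sum_distrib_left sum_distrib_right mult_scaleC_left
        mult_scaleC_right GG G1 G1')
  finally show a: "a = 0" using scal by simp
  show b: "\<forall>j\<in>{1..n}. b j = 0"
  proof
    fix j assume j: "j \<in> {1..n}"
    have "0 = star G * (star (S j) * ((\<Sum>i=1..n. b i *\<^sub>C S i) + (\<Sum>i=1..n. c i *\<^sub>C star (S i))) * G)"
      using assms a by simp
    also have "\<dots> = (\<Sum>i=1..n. b i *\<^sub>C (if j = i then 1 else 0))"
      using j by (simp add: distrib_left distrib_right sum_distrib_left sum_distrib_right
          mult_scaleC_left mult_scaleC_right mult.assoc G2' cuntz_star_mult_left if_distrib GG cong: if_cong)
    also have "\<dots> = b j *\<^sub>C 1" using j by (simp add: if_distrib cong: if_cong)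
    finally show "b j = 0" using scal by simp
  qed
  show "\<forall>j\<in>{1..n}. c j = 0"
  proof
    fix j assume j: "j \<in> {1..n}"
    have "0 = (\<Sum>i=1..n. c i *\<^sub>C star (S i)) * S j" using assms a b by simp
    also have "\<dots> = (\<Sum>i=1..n. c i *\<^sub>C (if i = j then 1 else 0))"
      using j by (simp add: sum_distrib_right mult_scaleC_left cuntz_star_mult)
    also have "\<dots> = c j *\<^sub>C 1" using j by (simp add: if_distrib cong: if_cong)
    finally show "c j = 0" using scal by simp
  qed
qed

lemma cuntz_basis_distinct:
  shows "inj_on S {1..n}" and "inj_on (\<lambda>i. star (S i)) {1..n}"
    and "i \<in> {1..n} \<Longrightarrow> S i \<noteq> 1" and "i \<in> {1..n} \<Longrightarrow> star (S i) \<noteq> 1"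
    and "i \<in> {1..n} \<Longrightarrow> j \<in> {1..n} \<Longrightarrow> S i \<noteq> star (S j)"
proof -
  show inj: "inj_on S {1..n}"
  proof (rule inj_onI)
    fix i j assume ij: "i \<in> {1..n}" "j \<in> {1..n}" and "S i = S j"
    then have "star (S i) * S j = 1" using cuntz_star_mult[of i i] by simp
    then show "i = j" using cuntz_star_mult[OF ij] by (simp split: if_splits)
  qed
  show "inj_on (\<lambda>i. star (S i)) {1..n}"
  proof (rule inj_onI)
    fix i j assume ij: "i \<in> {1..n}" "j \<in> {1..n}" and "star (S i) = star (S j)"
    then have "S i = S j" by (metis star_star)
    then show "i = j" using inj_onD[OF inj _ ij] by simp
  qed
  have other: "\<exists>k\<in>{1..n}. k \<noteq> i" for i
  proof (cases "i = 1")
    case True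
    then show ?thesis using n by (intro bexI[of _ 2]) auto
  next
    case False
    then show ?thesis using n by (intro bexI[of _ 1]) auto
  qed
  have nz: "star (S k) \<noteq> 0" if "k \<in> {1..n}" for k
    using cuntz_star_mult[OF that that] by auto
  show ne1: "S i \<noteq> 1" if "i \<in> {1..n}" for i
  proof
    assume eq: "S i = 1"
    obtain k where k: "k \<in> {1..n}" "k \<noteq> i" using other by blast
    with cuntz_star_mult[OF k(1) that] eq nz[OF k(1)] show False by simp
  qed
  show "star (S i) \<noteq> 1" if "i \<in> {1..n}" for i
  proof
    assume "star (S i) = 1"
    then have "star (star (S i)) = star 1" by (rule arg_cong)
    with ne1[OF that] show False by (simp add: star_star)
  qed
  show "S i \<noteq> star (S j)" if i: "i \<in> {1..n}" and j: "j \<in> {1..n}" for i j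
  proof
    assume eq: "S i = star (S j)"
    obtain k where k: "k \<in> {1..n}" "k \<noteq> i" using other by blast
    have "star (S k) * star (S j) = 0" using cuntz_star_mult[OF k(1) i] k(2) eq by simp
    then have "S j * S k = 0" by (metis star_mult star_star star_zero)
    then have "S k = 0" using cuntz_star_mult_left[OF j j, of "S k"] by simp
    with nz[OF k(1)] show False by simp
  qed
qed

lemma cuntz_basis_independent: "\<not> complex_vs.dependent (cuntz_basis n S)"
proof -
  have fin: "finite (cuntz_basis n S)" by (simp add: cuntz_basis_def)
  have "\<forall>v\<in>cuntz_basis n S. u v = 0" if "(\<Sum>v\<in>cuntz_basis n S. u v *\<^sub>C v) = 0" for u
  proof -
    have "(\<Sum>v\<in>cuntz_basis n S. u v *\<^sub>C v) = (\<Sum>v\<in>{1} \<union> S ` {1..n}. u v *\<^sub>C v)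
        + (\<Sum>v\<in>(\<lambda>i. star (S i)) ` {1..n}. u v *\<^sub>C v)"
      unfolding cuntz_basis_def
    proof (rule sum.union_disjoint)
      show "({1} \<union> S ` {1..n}) \<inter> (\<lambda>i. star (S i)) ` {1..n} = {}"
        using cuntz_basis_distinct(4,5) by (auto simp del: atLeastAtMost_iff)
    qed auto
    also have "(\<Sum>v\<in>{1} \<union> S ` {1..n}. u v *\<^sub>C v) = u 1 *\<^sub>C 1 + (\<Sum>v\<in>S ` {1..n}. u v *\<^sub>C v)"
    proof (subst sum.union_disjoint)
      show "{1} \<inter> S ` {1..n} = {}"
        using cuntz_basis_distinct(3) by (auto simp del: atLeastAtMost_iff)
    qed auto
    finally have "u 1 *\<^sub>C 1 + (\<Sum>i=1..n. u (S i) *\<^sub>C S i) + (\<Sum>i=1..n. u (star (S i)) *\<^sub>C star (S i)) = 0"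
      using that cuntz_basis_distinct by (simp add: sum.reindex)
    from cuntz_coefficients[OF this] show ?thesis by (auto simp: cuntz_basis_def)
  qed
  with fin show ?thesis by (auto simp: complex_vs.dependent_finite)
qed

lemma cuntz_delta_basis:
  assumes "b \<in> cuntz_basis n S" "b' \<in> cuntz_basis n S"
  shows "cuntz_delta n S b b' = (if b' = b then 1 else 0)"
  using complex_vs.representation_basis[OF cuntz_basis_independent assms(2)]
  by (simp add: cuntz_delta_def eq_commute)

lemma cuntz_delta_dual: "cuntz_delta n S b \<in> dual_space (cuntz_system n S)"
  unfolding dual_space_def cuntz_delta_def cuntz_system_def
  using complex_vs.representation_add[OF cuntz_basis_independent]
    complex_vs.representation_scale[OF cuntz_basis_independent]
  by (auto simp: complex_vs.representation_def)

lemma dual_basis_values: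
  assumes i: "i \<in> {1..n}" and j: "j \<in> {1..n}"
  shows "delta0 n S 1 = 1" "delta0 n S (S j) = 0" "delta0 n S (star (S j)) = 0"
    and "delta n S i 1 = 0" "delta n S i (S j) = (if i = j then 1 else 0)" "delta n S i (star (S j)) = 0"
    and "delta_star n S i 1 = 0" "delta_star n S i (S j) = 0"
      "delta_star n S i (star (S j)) = (if i = j then 1 else 0)"
proof -
  have mem1: "1 \<in> cuntz_basis n S" by (simp add: cuntz_basis_def)
  have memS: "S k \<in> cuntz_basis n S" "star (S k) \<in> cuntz_basis n S" if "k \<in> {1..n}" for k
    using that by (auto simp: cuntz_basis_def)
  note mem = mem1 memS[OF i] memS[OF j]
  note ne = cuntz_basis_distinct(3)[OF i] cuntz_basis_distinct(3)[OF j]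
    cuntz_basis_distinct(4)[OF i] cuntz_basis_distinct(4)[OF j]
    cuntz_basis_distinct(5)[OF i j] cuntz_basis_distinct(5)[OF j i]
  note d = delta0_def delta_def delta_star_def cuntz_delta_basis mem
  show "delta0 n S 1 = 1" "delta0 n S (S j) = 0" "delta0 n S (star (S j)) = 0"
    using ne by (auto simp: d)
  show "delta n S i 1 = 0" "delta n S i (star (S j)) = 0"
    "delta_star n S i 1 = 0" "delta_star n S i (S j) = 0"
    using ne by (auto simp: d)
  show "delta n S i (S j) = (if i = j then 1 else 0)"
    using inj_onD[OF cuntz_basis_distinct(1) _ i j] by (auto simp: d)
  show "delta_star n S i (star (S j)) = (if i = j then 1 else 0)"
    using inj_onD[OF cuntz_basis_distinct(2) _ i j] by (auto simp: d)
qed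

end

end

(* For sufficiency, dilate (A_1, ..., A_n) to a row with sum A_k A_k^* = I. For h in C^q let
   xi_N h be the sum of S_w T (x) A_w^* h over the words w of length at most N, with
   T = S_1^(N+1) S_2. Then the compressions xi_N(h)^* x xi_N(g) for x = 1, S_k, S_k^* are the
   scalars (N+1)<h, g>, N<A_k^* h, g>, N<h, A_k^* g>. Compressing a positive element over the
   operator system gives a sum of squares that is a scalar, hence nonnegative; divide by N and let
   N tend to infinity. For necessity, apply the map to the positive element (E_i^* E_j) with
   E = (1, S_1, ..., S_n) and evaluate at (u, -A_1^* u, ..., -A_n^* u). *)
theory Submission
  imports Defs
begin

section \<open>Positive semidefinite forms\<close>

text \<open>Positivity of \<open>X\<close> is witnessed by a matrix \<open>Y\<close> over the whole
  Cuntz algebra, while the map is defined only on the operator system, so it cannot be applied to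
  the entries of \<open>Y\<close>. Multiplying by vectors over the algebra itself avoids this: the
  outcome is again a sum of squares, and it is arranged to be a multiple of 1.

  Dilating to equality makes the counts come out: each word length then contributes the same
  \<open><h, g>\<close>, giving N+1 equal terms for the unit and N pairs of adjacent lengths for
  each generator. With a strict inequality the contributions would in general depend on the length.
  The ratio N/(N+1) is a weight of Fejer type, so a finite N only approximates the map.

  Products of words of different lengths leave non-scalar words behind, and T removes them: its
  power of S_1 is at least as long as any such remainder, and the final S_2 has range orthogonal to
  that of S_1.\<close>

definition psd_form :: "'i set \<Rightarrow> ('i \<Rightarrow> 'i \<Rightarrow> complex) \<Rightarrow> bool" where
  "psd_form I G \<longleftrightarrow> (\<forall>v. 0 \<le> (\<Sum>a\<in>I. \<Sum>b\<in>I. cnj (v a) * G a b * v b))"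

text \<open>Isolates the coordinate \<open>s\<close> at one index, so that the form can later be
  minimised over \<open>s\<close> with the other coordinates fixed.\<close>

lemma psd_form_insert:
  assumes "finite F" "x \<notin> F" "psd_form (insert x F) G"
  shows "0 \<le> cnj s * G x x * s + cnj s * (\<Sum>b\<in>F. G x b * v b) + (\<Sum>a\<in>F. cnj (v a) * G a x) * s
    + (\<Sum>a\<in>F. \<Sum>b\<in>F. cnj (v a) * G a b * v b)"
proof -
  define w where "w = v(x := s)"
  have w: "w x = s" "\<And>a. a \<in> F \<Longrightarrow> w a = v a" using assms(2) by (auto simp: w_def)
  have "0 \<le> (\<Sum>a\<in>insert x F. \<Sum>b\<in>insert x F. cnj (w a) * G a b * w b)"
    using assms(3) unfolding psd_form_def by blast
  also have "\<dots> = cnj s * G x x * s + (\<Sum>b\<in>F. cnj s * G x b * v b)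
      + ((\<Sum>a\<in>F. cnj (v a) * G a x * s) + (\<Sum>a\<in>F. \<Sum>b\<in>F. cnj (v a) * G a b * v b))"
    using assms(1,2) by (simp add: w sum.distrib)
  finally show ?thesis
    by (simp add: sum_distrib_left sum_distrib_right mult.assoc add.assoc)
qed

lemma psd_form_diag:
  assumes "finite I" "psd_form I G" "x \<in> I"
  shows "0 \<le> G x x"
  using psd_form_insert[of "I - {x}" x G 1 "\<lambda>_. 0"] assms by (simp add: insert_absorb)

lemma psd_form_pair:
  assumes "finite I" "psd_form I G" "x \<in> I" "y \<in> I" "x \<noteq> y"
  shows "0 \<le> cnj s * G x x * s + cnj s * G x y * t + cnj t * G y x * s + cnj t * G y y * t"
proof -
  have "0 \<le> (\<Sum>a\<in>I. \<Sum>b\<in>I. cnj (if a = x then s else if a = y then t else 0) * G a b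
      * (if b = x then s else if b = y then t else 0))"
    using assms(2) unfolding psd_form_def by (rule spec)
  also have "\<dots> = (\<Sum>a\<in>{x,y}. \<Sum>b\<in>{x,y}. cnj (if a = x then s else if a = y then t else 0) * G a b
      * (if b = x then s else if b = y then t else 0))"
    using assms by (intro sum.mono_neutral_cong_right ballI) (auto intro!: sum.neutral)
  also have "\<dots> = cnj s * G x x * s + cnj s * G x y * t + cnj t * G y x * s + cnj t * G y y * t"
    using assms(5) by simp
  finally show ?thesis .
qed

text \<open>Polarisation: the form takes real values, and its values at (1, 1) and (i, 1) on the
  pair of indices give the imaginary and the real part of the equation.\<close>

lemma psd_form_hermitian:
  assumes "finite I" "psd_form I G" "x \<in> I" "y \<in> I"
  shows "G y x = cnj (G x y)"
proof (cases "x = y")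
  case True
  then show ?thesis
    using psd_form_diag[OF assms(1-3)] by (simp add: complex_eq_iff less_eq_complex_def)
next
  case False
  have d: "Im (G x x) = 0" "Im (G y y) = 0"
    using psd_form_diag[OF assms(1,2)] assms(3,4) by (force simp: less_eq_complex_def)+
  from psd_form_pair[OF assms False, of 1 1] psd_form_pair[OF assms False, of \<i> 1] d
  show ?thesis by (simp add: complex_eq_iff less_eq_complex_def)
qed

text \<open>At the test vector \<open>(- r * G x y, 1)\<close> the form is affine in
  \<open>r\<close> with slope \<open>- 2 * (cmod (G x y))\<^sup>2\<close>, and it can stay
  nonnegative for all real \<open>r\<close> only if the slope is 0.\<close>

lemma psd_form_zero_diag:
  assumes "finite I" "psd_form I G" "x \<in> I" "y \<in> I" "G x x = 0"
  shows "G x y = 0"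
proof (cases "x = y")
  case False
  have H: "G y x = cnj (G x y)" by (rule psd_form_hermitian[OF assms(1-4)])
  have "2 * r * (cmod (G x y))\<^sup>2 \<le> Re (G y y)" for r :: real
  proof -
    have "0 \<le> Re (cnj (- of_real r * G x y) * G x y + G y x * (- of_real r * G x y) + G y y)"
      using psd_form_pair[OF assms(1-4) False, of "- of_real r * G x y" 1] assms(5)
      by (simp add: less_eq_complex_def)
    also have "\<dots> = Re (G y y) - 2 * r * (cmod (G x y))\<^sup>2"
      unfolding H cmod_power2 by (simp add: power2_eq_square algebra_simps)
    finally show ?thesis by simp
  qed
  note bound = this
  have "cmod (G x y) = 0"
  proof (rule ccontr)
    assume nz: "cmod (G x y) \<noteq> 0"
    have "2 * ((\<bar>Re (G y y)\<bar> + 1) / (cmod (G x y))\<^sup>2) * (cmod (G x y))\<^sup>2 \<le> Re (G y y)" by (rule bound)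
    with nz show False by simp
  qed
  then show ?thesis by simp
qed (use assms in simp)

text \<open>Cholesky factorisation: split off one index and pass to the Schur complement.\<close>

lemma psd_form_factor:
  assumes "finite I" "psd_form I G"
  shows "\<exists>D. \<forall>a\<in>I. \<forall>b\<in>I. G a b = (\<Sum>c\<in>I. D a c * cnj (D b c))"
  using assms
proof (induction I arbitrary: G rule: finite_induct)
  case empty
  then show ?case by simp
next
  case (insert x F)
  note fin = finite.insertI[OF insert.hyps(1), of x]
  have herm: "G b a = cnj (G a b)" if "a \<in> insert x F" "b \<in> insert x F" for a b
    using psd_form_hermitian[OF fin insert.prems that] .
  define g where "g = Re (G x x)"
  have g: "G x x = of_real g" "0 \<le> g"
    using psd_form_diag[OF fin insert.prems, of x] by (auto simp: g_def complex_eq_iff less_eq_complex_def)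
  \<comment> \<open>If \<open>g = 0\<close>, division by zero makes the correction term 0. This is
    the right value, since column \<open>x\<close> of \<open>G\<close> then vanishes by
    \<open>psd_form_zero_diag\<close>.\<close>
  define H where "H a b = G a b - G a x * cnj (G b x) / of_real g" for a b
  have "psd_form F H"
    unfolding psd_form_def
  proof
    fix v
    define L where "L = (\<Sum>b\<in>F. G x b * v b)"
    have L: "(\<Sum>a\<in>F. cnj (v a) * G a x) = cnj L"
      unfolding L_def by (auto simp: intro!: sum.cong herm[of x])
    have L': "(\<Sum>b\<in>F. cnj (G b x) * v b) = L"
      unfolding L_def by (auto intro!: sum.cong simp: herm[of x])
    have "(\<Sum>a\<in>F. \<Sum>b\<in>F. cnj (v a) * H a b * v b)
      = (\<Sum>a\<in>F. \<Sum>b\<in>F. cnj (v a) * G a b * v b) - (\<Sum>a\<in>F. cnj (v a) * G a x) * (\<Sum>b\<in>F. cnj (G b x) * v b) / of_real g"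
      unfolding sum_product H_def by (simp add: algebra_simps sum_subtractf sum_divide_distrib)
    also have "\<dots> = (\<Sum>a\<in>F. \<Sum>b\<in>F. cnj (v a) * G a b * v b) - cnj L * L / of_real g"
      by (simp add: L L')
    \<comment> \<open>Completing the square: for \<open>g > 0\<close> the coordinate
      \<open>- L / g\<close> at \<open>x\<close> minimises the form, and the minimum is the form of
      the Schur complement. For \<open>g = 0\<close> it is read as 0 and the equation still
      holds.\<close>
    also have "\<dots> = cnj (- L / of_real g) * G x x * (- L / of_real g) + cnj (- L / of_real g) * L
        + cnj L * (- L / of_real g) + (\<Sum>a\<in>F. \<Sum>b\<in>F. cnj (v a) * G a b * v b)"
      by (cases "g = 0") (simp_all add: g(1))
    also have "\<dots> \<ge> 0"
      using psd_form_insert[OF insert.hyps insert.prems, of "- L / of_real g" v] L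
      by (simp add: L_def)
    finally show "0 \<le> (\<Sum>a\<in>F. \<Sum>b\<in>F. cnj (v a) * H a b * v b)" .
  qed
  from insert.IH[OF this] obtain D where D: "\<And>a b. a \<in> F \<Longrightarrow> b \<in> F \<Longrightarrow> H a b = (\<Sum>c\<in>F. D a c * cnj (D b c))"
    by blast
  \<comment> \<open>Column \<open>x\<close> reproduces row and column \<open>x\<close> of
    \<open>G\<close>; the remaining columns factor \<open>H\<close> and are 0 in row
    \<open>x\<close>.\<close>
  define E where "E a c = (if c = x then G a x / of_real (sqrt g) else if a = x then 0 else D a c)" for a c
  have col: "G a x * cnj (G x x) / of_real g = G a x" if "a \<in> insert x F" for a
  proof (cases "g = 0")
    case True
    then have "G x a = 0" using psd_form_zero_diag[OF fin insert.prems _ that, of x] g by simp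
    then show ?thesis using herm[OF _ that, of x] by simp
  qed (simp add: g)
  have Ex: "E a x * cnj (E b x) = G a x * cnj (G b x) / of_real g" for a b
    using g(2) by (simp add: E_def flip: of_real_mult)
  have "G a b = (\<Sum>c\<in>insert x F. E a c * cnj (E b c))" if ab: "a \<in> insert x F" "b \<in> insert x F" for a b
  proof -
    have *: "(\<Sum>c\<in>insert x F. E a c * cnj (E b c))
        = G a x * cnj (G b x) / of_real g + (\<Sum>c\<in>F. E a c * cnj (E b c))"
      using insert.hyps Ex by simp
    show ?thesis
    proof (cases "a = x \<or> b = x")
      case True
      then have "(\<Sum>c\<in>F. E a c * cnj (E b c)) = 0"
        using insert.hyps by (intro sum.neutral) (auto simp: E_def)
      moreover have "G a b = G a x * cnj (G b x) / of_real g"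
      proof (cases "b = x")
        case False
        with True have "a = x" by simp
        then show ?thesis using col[OF ab(2)] herm[of b x] ab g(1) by (cases "g = 0") auto
      qed (use col ab in auto)
      ultimately show ?thesis using * by simp
    next
      case False
      with ab have F: "a \<in> F" "b \<in> F" by auto
      have "(\<Sum>c\<in>F. E a c * cnj (E b c)) = H a b"
        unfolding D[OF F] using False insert.hyps by (intro sum.cong) (auto simp: E_def)
      then show ?thesis using * by (simp add: H_def)
    qed
  qed
  then show ?case by blast
qed

declare One_nat_def [simp del]

section \<open>Compressions of the Cuntz isometries\<close>

definition ip :: "'i set \<Rightarrow> ('i \<Rightarrow> complex) \<Rightarrow> ('i \<Rightarrow> complex) \<Rightarrow> complex" where
  "ip I h g = (\<Sum>a\<in>I. cnj (h a) * g a)"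

definition adj_app :: "'i set \<Rightarrow> ('i \<Rightarrow> 'i \<Rightarrow> complex) \<Rightarrow> ('i \<Rightarrow> complex) \<Rightarrow> 'i \<Rightarrow> complex" where
  "adj_app I M h = (\<lambda>c. \<Sum>b\<in>I. cnj (M b c) * h b)"

lemma cnj_ip: "cnj (ip I h g) = ip I g h"
  by (simp add: ip_def mult.commute)

text \<open>\<open><M^* h, M^* g> = <h, M M^* g>\<close>, summed over the row. It translates
  conditions on the sum of the \<open>M M^*\<close> into conditions on the adjoints, which are what
  words act by.\<close>

lemma sum_ip_adj_app:
  "(\<Sum>k\<in>K. ip I (adj_app I (M k) h) (adj_app I (M k) g))
    = (\<Sum>a\<in>I. \<Sum>b\<in>I. cnj (h a) * (\<Sum>k\<in>K. \<Sum>c\<in>I. M k a c * cnj (M k b c)) * g b)"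
proof -
  have "(\<Sum>k\<in>K. ip I (adj_app I (M k) h) (adj_app I (M k) g))
      = (\<Sum>k\<in>K. \<Sum>c\<in>I. \<Sum>a\<in>I. \<Sum>b\<in>I. cnj (h a) * (M k a c * cnj (M k b c)) * g b)"
    unfolding ip_def adj_app_def cnj_sum sum_product by (simp only: complex_cnj_mult complex_cnj_cnj mult_ac)
  also have "\<dots> = (\<Sum>k\<in>K. \<Sum>a\<in>I. \<Sum>b\<in>I. \<Sum>c\<in>I. cnj (h a) * (M k a c * cnj (M k b c)) * g b)"
    by (rule sum.cong[OF refl], subst sum.swap, rule sum.cong[OF refl], rule sum.swap)
  also have "\<dots> = (\<Sum>a\<in>I. \<Sum>b\<in>I. \<Sum>k\<in>K. \<Sum>c\<in>I. cnj (h a) * (M k a c * cnj (M k b c)) * g b)"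
    by (subst sum.swap, rule sum.cong[OF refl], rule sum.swap)
  finally show ?thesis by (simp only: sum_distrib_left sum_distrib_right)
qed

lemma star_power: "star (x ^ k) = star x ^ k" for x :: "'a :: cstar_algebra"
  by (induction k) (simp_all add: star_mult power_commutes)

section \<open>Sums of squares in the Cuntz algebra and the isometry \<open>T\<close>\<close>

context
  fixes n :: nat and S :: "nat \<Rightarrow> 'a :: cstar_algebra"
  assumes n: "2 \<le> n" and C: "cuntz_algebra n S"
begin

lemma one_two: "1 \<in> {1..n}" "2 \<in> {1..n}"
  using n by auto

lemmas rel = cuntz_star_mult[OF n C] cuntz_star_mult_left[OF n C]

text \<open>\<open>S 1\<close> and \<open>S 2\<close> are isometries with orthogonal ranges, so the
  square of \<open>S 1 * a + S 2 * b\<close> is the sum of the squares of \<open>a\<close> and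
  \<open>b\<close>.\<close>

lemma sum_squares_merge:
  assumes "finite J"
  shows "\<exists>y. (\<Sum>j\<in>J. star (z j) * z j) = star y * (y :: 'a)"
  using assms
proof (induction J rule: finite_induct)
  case empty
  show ?case by (intro exI[of _ 0]) simp
next
  case (insert x F)
  then obtain y where "(\<Sum>j\<in>F. star (z j) * z j) = star y * y" by blast
  then show ?case
    using insert.hyps one_two
    by (intro exI[of _ "S 1 * z x + S 2 * y"])
      (simp add: star_add star_mult distrib_left distrib_right mult.assoc rel)
qed

text \<open>If \<open>c < 0\<close> then \<open>w = sqrt (- c) S\<^sub>1 + S\<^sub>2 y\<close> satisfies \<open>w\<^sup>* w = - c + y\<^sup>* y = 0\<close>, so \<open>w = 0\<close>;
  this avoids the general theory of positive elements.\<close>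

lemma scalar_sum_squares_nonneg:
  assumes "finite J" "(\<Sum>j\<in>J. star (z j) * z j) = c *\<^sub>C (1 :: 'a)"
  shows "0 \<le> c"
proof -
  obtain y where y: "star y * y = c *\<^sub>C (1 :: 'a)" using sum_squares_merge[OF assms(1)] assms(2) by metis
  have "cnj c *\<^sub>C (1 :: 'a) = c *\<^sub>C 1"
    by (metis star_mult star_star star_scaleC star_one y)
  then have "cnj c = c" by (metis complex_vs.scale_right_imp_eq zero_neq_one)
  then have im: "Im c = 0" by (simp add: complex_eq_iff)
  have "\<not> Re c < 0"
  proof
    assume neg: "Re c < 0"
    define r where "r = complex_of_real (sqrt (- Re c))"
    have rr: "cnj r * r + c = 0"
      using neg im by (simp add: r_def complex_eq_iff flip: of_real_mult)
    define w where "w = r *\<^sub>C S 1 + S 2 * y"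
    have "star w * w = (cnj r * r) *\<^sub>C 1 + star y * y"
      using one_two by (simp add: w_def star_add star_mult star_scaleC distrib_left distrib_right
          mult.assoc rel mult_scaleC_left mult_scaleC_right scaleC_scaleC)
    also have "\<dots> = 0" using rr by (simp add: y flip: scaleC_add_left)
    finally have "w = 0" using cstar_identity[of w] by simp
    then have "star (S 1) * w = 0" by simp
    then have "r *\<^sub>C (1 :: 'a) = 0"
      using one_two by (simp add: w_def distrib_left mult_scaleC_right rel)
    then have "r = 0" by (metis complex_vs.scale_eq_0_iff zero_neq_one)
    with neg show False by (simp add: r_def)
  qed
  with im show ?thesis by (simp add: less_eq_complex_def)
qed

definition T where "T M = S 1 ^ M * S 2"

lemma star_power_mult_power: "star (S 1) ^ k * (S 1 ^ (k + d) * x) = S 1 ^ d * x"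
proof (induction k)
  case (Suc k)
  have "star (S 1) ^ Suc k * (S 1 ^ (Suc k + d) * x) = star (S 1) ^ k * (star (S 1) * (S 1 * (S 1 ^ (k + d) * x)))"
    by (simp only: power_Suc2[of "star (S 1)"] add_Suc power_Suc[of "S 1"] mult.assoc)
  then show ?case using Suc one_two by (simp add: rel)
qed simp

lemma T_isometry: "star (T M) * T M = 1"
  using one_two star_power_mult_power[of M 0 "S 2"]
  by (simp add: T_def star_mult star_power mult.assoc rel)

text \<open>The hypothesis is met by words of length \<open>d\<close>. Cancelling powers of
  \<open>S 1\<close> reduces the product to a multiple of
  \<open>star (S 2) * (S 1 ^ d * S 2)\<close>, which is 0 once \<open>d\<close> is positive;
  \<open>d \<le> M\<close> leaves enough copies of \<open>star (S 1)\<close> in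
  \<open>star (T M)\<close>.\<close>

lemma T_kills:
  assumes "star (S 1) ^ d * y = c *\<^sub>C 1" "1 \<le> d" "d \<le> M"
  shows "star (T M) * y * T M = 0"
proof -
  have "star (S 1) ^ M * y = star (S 1) ^ (M - d) * (star (S 1) ^ d * y)"
    using assms(3) power_add[of "star (S 1)" "M - d" d] by (simp only: mult.assoc[symmetric]) simp
  also have "\<dots> = c *\<^sub>C star (S 1) ^ (M - d)" by (simp add: assms(1) mult_scaleC_right)
  finally have "star (T M) * y * T M = c *\<^sub>C (star (S 2) * (star (S 1) ^ (M - d) * (S 1 ^ M * S 2)))"
    by (simp add: T_def star_mult star_power mult.assoc mult_scaleC_right mult_scaleC_left
        flip: mult.assoc[of "star (S 1) ^ M" y])
  also have "star (S 1) ^ (M - d) * (S 1 ^ M * S 2) = S 1 ^ d * S 2"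
    using star_power_mult_power[of "M - d" d "S 2"] assms(3) by simp
  also have "star (S 2) * (S 1 ^ d * S 2) = 0"
    using assms(2) one_two by (cases d) (simp_all add: mult.assoc rel)
  finally show ?thesis by simp
qed

section \<open>Words weighted by a coisometric row, and the compressions they define\<close>

context
  fixes I :: "'i set" and \<alpha> :: "nat \<Rightarrow> 'i \<Rightarrow> 'i \<Rightarrow> complex"
  assumes fin: "finite I"
    and coiso: "\<And>a b. a \<in> I \<Longrightarrow> b \<in> I \<Longrightarrow>
      (\<Sum>k=1..n. \<Sum>c\<in>I. \<alpha> k a c * cnj (\<alpha> k b c)) = (if a = b then 1 else 0)"
begin

text \<open>\<open>\<eta> l h = \<Sum>\<^bsub>|w| = l\<^esub> S\<^sub>w \<otimes> A\<^sub>w\<^sup>* h\<close>, summed over the words \<open>w\<close> of length \<open>l\<close>.\<close>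

primrec \<eta> :: "nat \<Rightarrow> ('i \<Rightarrow> complex) \<Rightarrow> 'i \<Rightarrow> 'a" where
  "\<eta> 0 h a = h a *\<^sub>C 1"
| "\<eta> (Suc l) h a = (\<Sum>k=1..n. S k * \<eta> l (adj_app I (\<alpha> k) h) a)"

text \<open>The inner product, with values in the algebra, of the levels \<open>l\<close> and
  \<open>l'\<close>: scalar if the lengths agree, and otherwise made of words that \<open>T\<close>
  annihilates.\<close>

definition \<eta>_ip where "\<eta>_ip l l' h g = (\<Sum>a\<in>I. star (\<eta> l h a) * \<eta> l' g a)"

lemma star_S_\<eta>:
  assumes "k \<in> {1..n}"
  shows "star (S k) * \<eta> (Suc l) h a = \<eta> l (adj_app I (\<alpha> k) h) a"
proof -
  have "star (S k) * \<eta> (Suc l) h a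
      = (\<Sum>j=1..n. if j = k then \<eta> l (adj_app I (\<alpha> j) h) a else 0)"
    unfolding \<eta>.simps sum_distrib_left by (rule sum.cong) (use assms rel in auto)
  then show ?thesis using assms by simp
qed

lemma ip_coisometry: "(\<Sum>k=1..n. ip I (adj_app I (\<alpha> k) h) (adj_app I (\<alpha> k) g)) = ip I h g"
  unfolding sum_ip_adj_app using fin
  by (simp add: coiso ip_def if_distrib[of "\<lambda>x. _ * x * _"] cong: if_cong)

text \<open>Orthogonality of the ranges forces the first letters of both words to agree, and that
  common letter cancels.\<close>

lemma \<eta>_ip_Suc:
  "\<eta>_ip (Suc l) (Suc l') h g = (\<Sum>k=1..n. \<eta>_ip l l' (adj_app I (\<alpha> k) h) (adj_app I (\<alpha> k) g))"
proof -
  have "star (\<eta> (Suc l) h a) * \<eta> (Suc l') g a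
      = (\<Sum>k=1..n. star (\<eta> l (adj_app I (\<alpha> k) h) a) * \<eta> l' (adj_app I (\<alpha> k) g) a)" for a
  proof -
    have "star (\<eta> (Suc l) h a) * \<eta> (Suc l') g a
        = (\<Sum>k=1..n. star (\<eta> l (adj_app I (\<alpha> k) h) a) * (star (S k) * \<eta> (Suc l') g a))"
      by (simp add: star_sum star_mult sum_distrib_right mult.assoc)
    then show ?thesis by (simp add: star_S_\<eta> del: \<eta>.simps)
  qed
  then show ?thesis unfolding \<eta>_ip_def by (subst sum.swap) (rule sum.cong, auto)
qed

lemma \<eta>_ip_same: "\<eta>_ip l l h g = ip I h g *\<^sub>C 1"
proof (induction l arbitrary: h g)
  case 0
  show ?case by (simp add: \<eta>_ip_def ip_def star_scaleC mult_scaleC_left scaleC_scaleC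
        complex_vs.scale_sum_left)
next
  case (Suc l)
  then show ?case by (simp add: \<eta>_ip_Suc ip_coisometry flip: complex_vs.scale_sum_left)
qed

text \<open>Only the word consisting of \<open>l\<close> letters \<open>S 1\<close> survives,
  leaving its scalar coefficient. This supplies the hypothesis of \<open>T_kills\<close>.\<close>

lemma star_power_\<eta>: "\<exists>c. star (S 1) ^ l * \<eta> l h a = c *\<^sub>C 1"
proof (induction l arbitrary: h)
  case (Suc l)
  have "star (S 1) ^ Suc l * \<eta> (Suc l) h a = star (S 1) ^ l * (star (S 1) * \<eta> (Suc l) h a)"
    by (simp only: power_Suc2 mult.assoc)
  then show ?case using Suc one_two by (simp add: star_S_\<eta> del: \<eta>.simps)
qed auto

lemma star_\<eta>_ip: "star (\<eta>_ip l l' h g) = \<eta>_ip l' l g h"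
  by (simp add: \<eta>_ip_def star_sum star_mult star_star)

text \<open>Cancelling common first letters uses up the shorter word; a nonempty remainder of the
  longer one is left for \<open>T_kills\<close>.\<close>

lemma T_\<eta>_ip_less:
  assumes "l < l'" "l' \<le> M"
  shows "star (T M) * \<eta>_ip l l' h g * T M = 0"
  using assms
proof (induction l arbitrary: l' h g)
  case 0
  have "star (T M) * \<eta> l' g a * T M = 0" for a
    using star_power_\<eta>[of l' g a] T_kills 0 by (metis One_nat_def Suc_leI)
  then show ?case
    by (simp add: \<eta>_ip_def sum_distrib_left sum_distrib_right star_scaleC mult_scaleC_left mult_scaleC_right)
next
  case (Suc l)
  then obtain d where d: "l' = Suc d" by (cases l') auto
  show ?case using Suc
    by (simp add: d \<eta>_ip_Suc sum_distrib_left sum_distrib_right)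
qed

lemma T_\<eta>_ip:
  assumes "l \<le> M" "l' \<le> M"
  shows "star (T M) * \<eta>_ip l l' h g * T M = (if l = l' then ip I h g else 0) *\<^sub>C 1"
proof (cases l l' rule: linorder_cases)
  case less
  then show ?thesis using T_\<eta>_ip_less assms by simp
next
  case equal
  then show ?thesis by (simp add: \<eta>_ip_same mult_scaleC_left mult_scaleC_right T_isometry)
next
  case greater
  then have "star (star (T M) * \<eta>_ip l' l g h * T M) = 0" using T_\<eta>_ip_less assms by simp
  then show ?thesis using greater by (simp add: star_mult star_star star_\<eta>_ip mult.assoc)
qed

definition \<xi> where "\<xi> N h a = (\<Sum>l\<le>N. \<eta> l h a) * T (Suc N)"

definition compr where "compr N h x g = (\<Sum>a\<in>I. star (\<xi> N h a) * x * \<xi> N g a)"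

lemma compr_expand:
  "compr N h x g = (\<Sum>l\<le>N. \<Sum>l'\<le>N.
    star (T (Suc N)) * (\<Sum>a\<in>I. star (\<eta> l h a) * x * \<eta> l' g a) * T (Suc N))"
proof -
  have "compr N h x g = (\<Sum>a\<in>I. \<Sum>l\<le>N. \<Sum>l'\<le>N.
    star (T (Suc N)) * (star (\<eta> l h a) * x * \<eta> l' g a) * T (Suc N))"
    unfolding compr_def
  proof (rule sum.cong[OF refl])
    fix a
    have "(\<Sum>l\<le>N. star (\<eta> l h a)) * x * (\<Sum>l'\<le>N. \<eta> l' g a)
        = (\<Sum>l\<le>N. \<Sum>l'\<le>N. star (\<eta> l h a) * x * \<eta> l' g a)"
      by (simp only: sum_distrib_right[of _ _ x] sum_product)
    moreover have "star (\<xi> N h a) * x * \<xi> N g a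
        = star (T (Suc N)) * ((\<Sum>l\<le>N. star (\<eta> l h a)) * x * (\<Sum>l'\<le>N. \<eta> l' g a)) * T (Suc N)"
      by (simp only: \<xi>_def star_mult star_sum mult.assoc)
    ultimately show "star (\<xi> N h a) * x * \<xi> N g a
        = (\<Sum>l\<le>N. \<Sum>l'\<le>N. star (T (Suc N)) * (star (\<eta> l h a) * x * \<eta> l' g a) * T (Suc N))"
      by (simp only: sum_distrib_left sum_distrib_right)
  qed
  also have "\<dots> = (\<Sum>l\<le>N. \<Sum>l'\<le>N. \<Sum>a\<in>I.
    star (T (Suc N)) * (star (\<eta> l h a) * x * \<eta> l' g a) * T (Suc N))"
    by (subst sum.swap, rule sum.cong[OF refl], rule sum.swap)
  finally show ?thesis by (simp add: sum_distrib_left sum_distrib_right)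
qed

lemma compr_one: "compr N h 1 g = (of_nat (Suc N) * ip I h g) *\<^sub>C 1"
proof -
  have "compr N h 1 g = (\<Sum>l\<le>N. \<Sum>l'\<le>N. (if l = l' then ip I h g else 0) *\<^sub>C 1)"
    unfolding compr_expand
    by (intro sum.cong refl) (simp add: T_\<eta>_ip flip: \<eta>_ip_def)
  also have "\<dots> = (\<Sum>l\<le>N. \<Sum>l'\<le>N. if l = l' then ip I h g else 0) *\<^sub>C 1"
    by (simp only: complex_vs.scale_sum_left)
  finally show ?thesis by simp
qed

text \<open>\<open>S k\<close> raises the length of the right-hand word by one, so level
  \<open>l'\<close> is paired with level \<open>l' + 1\<close>. Both must be at most
  \<open>N\<close>, which leaves \<open>N\<close> pairs instead of \<open>N + 1\<close>.\<close>

lemma compr_S: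
  assumes k: "k \<in> {1..n}"
  shows "compr N h (S k) g = (of_nat N * ip I (adj_app I (\<alpha> k) h) g) *\<^sub>C 1"
proof -
  let ?h = "adj_app I (\<alpha> k) h"
  have *: "star (T (Suc N)) * (\<Sum>a\<in>I. star (\<eta> l h a) * S k * \<eta> l' g a) * T (Suc N)
      = (if l = Suc l' then ip I ?h g else 0) *\<^sub>C 1" if l: "l \<le> N" "l' \<le> N" for l l'
  \<comment> \<open>For \<open>l = 0\<close> there is no letter on the left to absorb
    \<open>S k\<close>, so \<open>T\<close> has to annihilate words of length \<open>l' + 1\<close>.
    These can have length \<open>N + 1\<close>, whence the exponent \<open>Suc N\<close> in
    \<open>\<xi>\<close>.\<close>
  proof (cases l)
    case 0
    have "star (T (Suc N)) * (S k * \<eta> l' g a) * T (Suc N) = 0" for a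
    proof -
      have "\<exists>c. star (S 1) ^ Suc l' * (S k * \<eta> l' g a) = c *\<^sub>C 1"
      proof (cases "k = 1")
        case True
        have "star (S 1) ^ Suc l' * (S k * \<eta> l' g a) = star (S 1) ^ l' * \<eta> l' g a"
          using one_two True by (simp add: power_Suc2 mult.assoc rel del: power_Suc)
        then show ?thesis using star_power_\<eta> by simp
      next
        case False
        have "star (S 1) ^ Suc l' * (S k * \<eta> l' g a) = 0"
          using one_two k False by (simp add: power_Suc2 mult.assoc rel del: power_Suc)
        then show ?thesis by (intro exI[of _ 0]) simp
      qed
      then show ?thesis using T_kills[of "Suc l'"] l by auto
    qed
    then show ?thesis
      by (simp add: 0 sum_distrib_left sum_distrib_right star_scaleC mult_scaleC_left
          mult_scaleC_right mult.assoc)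
  next
    case (Suc d)
    have "star (\<eta> l h a) * S k = star (\<eta> d ?h a)" for a
      using arg_cong[OF star_S_\<eta>[OF k, of d h a], of star]
      by (simp add: Suc star_mult star_star del: \<eta>.simps)
    then show ?thesis using l Suc by (simp add: T_\<eta>_ip flip: \<eta>_ip_def)
  qed
  have "compr N h (S k) g = (\<Sum>l\<le>N. \<Sum>l'\<le>N. (if l = Suc l' then ip I ?h g else 0) *\<^sub>C 1)"
    unfolding compr_expand by (intro sum.cong refl) (simp add: *)
  also have "\<dots> = (\<Sum>l'\<le>N. \<Sum>l\<le>N. if l = Suc l' then ip I ?h g else 0) *\<^sub>C 1"
    by (subst sum.swap) (simp flip: complex_vs.scale_sum_left)
  also have "(\<Sum>l'\<le>N. \<Sum>l\<le>N. if l = Suc l' then ip I ?h g else 0) = (\<Sum>l'<N. ip I ?h g)"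
    by (rule sum.mono_neutral_cong_right) (auto simp: Suc_le_eq)
  finally show ?thesis by simp
qed

lemma star_compr: "star (compr N h x g) = compr N g (star x) h"
  by (simp add: compr_def star_sum star_mult star_star mult.assoc)

lemma compr_star_S:
  assumes "k \<in> {1..n}"
  shows "compr N h (star (S k)) g = (of_nat N * ip I h (adj_app I (\<alpha> k) g)) *\<^sub>C 1"
  using star_compr[of N g "S k" h] by (simp add: compr_S[OF assms] star_scaleC cnj_ip)

lemma compr_add: "compr N h (x + y) g = compr N h x g + compr N h y g"
  by (simp add: compr_def distrib_left distrib_right sum.distrib)

lemma compr_scaleC: "compr N h (c *\<^sub>C x) g = c *\<^sub>C compr N h x g"
  by (simp add: compr_def mult_scaleC_left mult_scaleC_right complex_vs.scale_sum_right)

lemma compr_sum: "compr N h (sum f K) g = (\<Sum>k\<in>K. compr N h (f k) g)"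
  by (induction K rule: infinite_finite_induct) (simp_all add: compr_add, simp_all add: compr_def)

lemma compr_system:
  "compr N h (c *\<^sub>C 1 + (\<Sum>k=1..n. b k *\<^sub>C S k) + (\<Sum>k=1..n. d k *\<^sub>C star (S k))) g
    = (of_nat (Suc N) * (c * ip I h g)
      + of_nat N * (\<Sum>k=1..n. b k * ip I (adj_app I (\<alpha> k) h) g + d k * ip I h (adj_app I (\<alpha> k) g))) *\<^sub>C 1"
proof -
  have "compr N h (c *\<^sub>C 1 + (\<Sum>k=1..n. b k *\<^sub>C S k) + (\<Sum>k=1..n. d k *\<^sub>C star (S k))) g
    = (c * (of_nat (Suc N) * ip I h g)) *\<^sub>C 1
      + (\<Sum>k=1..n. (b k * (of_nat N * ip I (adj_app I (\<alpha> k) h) g)) *\<^sub>C 1)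
      + (\<Sum>k=1..n. (d k * (of_nat N * ip I h (adj_app I (\<alpha> k) g))) *\<^sub>C 1)"
    by (simp add: compr_add compr_sum compr_scaleC compr_one compr_S compr_star_S scaleC_scaleC
        del: of_nat_Suc)
  then show ?thesis
    by (simp add: sum.distrib sum_distrib_left distrib_left mult_ac
        del: of_nat_Suc flip: scaleC_add_left complex_vs.scale_sum_left)
qed

lemma coisometric_form_nonneg:
  assumes J: "finite J"
    and X: "\<And>i j. i \<in> J \<Longrightarrow> j \<in> J \<Longrightarrow> (\<Sum>r\<in>J. star (Y r i) * Y r j)
      = c i j *\<^sub>C 1 + (\<Sum>k=1..n. b i j k *\<^sub>C S k) + (\<Sum>k=1..n. d i j k *\<^sub>C star (S k))"
  shows "0 \<le> (\<Sum>i\<in>J. \<Sum>j\<in>J. c i j * ip I (h i) (h j)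
    + (\<Sum>k=1..n. b i j k * ip I (adj_app I (\<alpha> k) (h i)) (h j) + d i j k * ip I (h i) (adj_app I (\<alpha> k) (h j))))"
proof -
  define P where "P = (\<Sum>i\<in>J. \<Sum>j\<in>J. c i j * ip I (h i) (h j))"
  define Q where "Q = (\<Sum>i\<in>J. \<Sum>j\<in>J. \<Sum>k=1..n. b i j k * ip I (adj_app I (\<alpha> k) (h i)) (h j)
    + d i j k * ip I (h i) (adj_app I (\<alpha> k) (h j)))"
  \<comment> \<open>The expression equals \<open>P + N * (P + Q)\<close>, so its nonnegativity for
    every \<open>N\<close> forces \<open>0 \<le> P + Q\<close>; the surplus \<open>P\<close> does
    not grow with \<open>N\<close>.\<close>
  have pos: "0 \<le> of_nat (Suc N) * P + of_nat N * Q" for N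
  proof -
    \<comment> \<open>\<open>Y\<close> applied to the column of the \<open>\<xi> N (h j)\<close>,
      one entry for each coordinate \<open>a\<close> and each row \<open>r\<close>. Summing the
      squares over \<open>r\<close> turns \<open>Y\<close> into
      \<open>star_mat Y * Y\<close>.\<close>
    define z where "z = (\<lambda>(a, r). \<Sum>j\<in>J. Y r j * \<xi> N (h j) a)"
    have "(\<Sum>q\<in>I \<times> J. star (z q) * z q)
        = (\<Sum>a\<in>I. \<Sum>r\<in>J. \<Sum>i\<in>J. \<Sum>j\<in>J. star (\<xi> N (h i) a) * (star (Y r i) * Y r j) * \<xi> N (h j) a)"
      by (simp add: z_def sum.cartesian_product' star_sum star_mult sum_product mult.assoc)
    also have "\<dots> = (\<Sum>a\<in>I. \<Sum>i\<in>J. \<Sum>j\<in>J. \<Sum>r\<in>J. star (\<xi> N (h i) a) * (star (Y r i) * Y r j) * \<xi> N (h j) a)"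
      by (rule sum.cong[OF refl], subst sum.swap, rule sum.cong[OF refl], rule sum.swap)
    also have "\<dots> = (\<Sum>i\<in>J. \<Sum>j\<in>J. \<Sum>a\<in>I. \<Sum>r\<in>J. star (\<xi> N (h i) a) * (star (Y r i) * Y r j) * \<xi> N (h j) a)"
      by (subst sum.swap, rule sum.cong[OF refl], rule sum.swap)
    also have "\<dots> = (\<Sum>i\<in>J. \<Sum>j\<in>J. compr N (h i) (\<Sum>r\<in>J. star (Y r i) * Y r j) (h j))"
      by (simp only: compr_def sum_distrib_left sum_distrib_right)
    also have "\<dots> = (of_nat (Suc N) * P + of_nat N * Q) *\<^sub>C 1"
      by (simp only: X compr_system P_def Q_def sum_distrib_left distrib_left sum.distrib
          complex_vs.scale_sum_left[symmetric] cong: sum.cong)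
    finally show ?thesis using scalar_sum_squares_nonneg[of "I \<times> J" z] fin J by simp
  qed
  have "Im (P + Q) = 0"
    using pos[of 0] pos[of 1] by (simp add: less_eq_complex_def)
  moreover have "0 \<le> Re (P + Q)"
  proof (rule ccontr)
    assume "\<not> 0 \<le> Re (P + Q)"
    then have neg: "0 < - Re (P + Q)" by simp
    from reals_Archimedean3[OF neg] obtain N where "Re P < real N * - Re (P + Q)" by blast
    moreover have "0 \<le> Re P + real N * Re (P + Q)"
      using pos[of N] by (simp add: less_eq_complex_def algebra_simps)
    ultimately show False by (simp add: algebra_simps)
  qed
  ultimately have "0 \<le> P + Q" by (simp add: less_eq_complex_def)
  then show ?thesis by (simp add: P_def Q_def sum.distrib)
qed

end

text \<open>The row \<open>(A\<^sub>1, \<dots>, A\<^sub>n)\<close> is the corner of a coisometric row: with \<open>D D\<^sup>* = I - \<Sum> A\<^sub>k A\<^sub>k\<^sup>*\<close> put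
  \<open>D\<close> to the right of \<open>A\<^sub>1\<close> and the identity in the lower right corner of \<open>A\<^sub>2\<close>.\<close>

lemma contraction_form_nonneg:
  fixes I :: "'i set"
  assumes fin: "finite I"
    and contr: "psd_form I (\<lambda>a b. (if a = b then 1 else 0) - (\<Sum>k=1..n. \<Sum>c\<in>I. M k a c * cnj (M k b c)))"
    and J: "finite J"
    and X: "\<And>i j. i \<in> J \<Longrightarrow> j \<in> J \<Longrightarrow> (\<Sum>r\<in>J. star (Y r i) * Y r j)
      = c i j *\<^sub>C 1 + (\<Sum>k=1..n. b i j k *\<^sub>C S k) + (\<Sum>k=1..n. d i j k *\<^sub>C star (S k))"
  shows "0 \<le> (\<Sum>i\<in>J. \<Sum>j\<in>J. c i j * ip I (h i) (h j)
    + (\<Sum>k=1..n. b i j k * ip I (adj_app I (M k) (h i)) (h j) + d i j k * ip I (h i) (adj_app I (M k) (h j))))"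
proof -
  obtain D where D: "\<And>a b. a \<in> I \<Longrightarrow> b \<in> I \<Longrightarrow>
      (if a = b then 1 else 0) - (\<Sum>k=1..n. \<Sum>c\<in>I. M k a c * cnj (M k b c)) = (\<Sum>c\<in>I. D a c * cnj (D b c))"
    using psd_form_factor[OF fin contr] by blast
  \<comment> \<open>\<open>D\<close> and the identity share a block column, so they are assigned to
    the different generators 1 and 2. This makes their cross terms vanish.\<close>
  define N where "N k = case_sum
      (\<lambda>a. case_sum (M k a) (\<lambda>c. if k = 1 then D a c else 0))
      (\<lambda>a. case_sum (\<lambda>_. 0) (\<lambda>c. if k = 2 \<and> a = c then 1 else 0))" for k
  define E where "E u = case_sum u (\<lambda>_::'i. 0 :: complex)" for u :: "'i \<Rightarrow> complex"
  have coiso: "(\<Sum>k=1..n. \<Sum>c\<in>I <+> I. N k a c * cnj (N k a' c)) = (if a = a' then 1 else 0)"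
    if a: "a \<in> I <+> I" "a' \<in> I <+> I" for a a'
  proof -
    have split: "(\<Sum>k=1..n. \<Sum>c\<in>I <+> I. N k a c * cnj (N k a' c))
      = (\<Sum>k=1..n. \<Sum>c\<in>I. N k a (Inl c) * cnj (N k a' (Inl c)))
        + (\<Sum>c\<in>I. \<Sum>k=1..n. N k a (Inr c) * cnj (N k a' (Inr c)))"
      by (subst (2) sum.swap) (simp add: sum.Plus fin sum.distrib)
    have if1: "(\<Sum>k=1..n. if k = 1 then z else 0) = z" "(\<Sum>k=1..n. if k = 2 then z else 0) = z"
      for z :: complex using one_two by simp_all
    have *: "N k (Inl x) (Inr c) * cnj (N k (Inl y) (Inr c)) = (if k = 1 then D x c * cnj (D y c) else 0)"
      "N k (Inl x) (Inr c) * cnj (N k (Inr y) (Inr c)) = 0"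
      "N k (Inr x) (Inr c) * cnj (N k (Inl y) (Inr c)) = 0"
      "N k (Inr x) (Inr c) * cnj (N k (Inr y) (Inr c)) = (if k = 2 then if x = c \<and> y = c then 1 else 0 else 0)"
      "N k (Inl x) (Inl c) = M k x c" "N k (Inr x) (Inl c) = 0" for k x y c
      by (auto simp: N_def)
    from a consider
        x y where "a = Inl x" "a' = Inl y" "x \<in> I" "y \<in> I"
      | x y where "a = Inl x" "a' = Inr y" "x \<in> I" "y \<in> I"
      | x y where "a = Inr x" "a' = Inl y" "x \<in> I" "y \<in> I"
      | x y where "a = Inr x" "a' = Inr y" "x \<in> I" "y \<in> I" by auto
    then show ?thesis
    proof cases
      case 1
      then show ?thesis unfolding split using D[of x y] by (simp add: * if1 algebra_simps split: if_splits)
    next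
      case 4
      have "(\<Sum>c\<in>I. if x = c \<and> y = c then 1 else 0) = (if x = y then 1 else 0 :: complex)"
        using 4 fin by (cases "x = y") (auto intro: sum.neutral)
      then show ?thesis unfolding split using 4 by (simp add: * if1)
    qed (unfold split, simp_all add: *)
  qed
  \<comment> \<open>The adjoint of \<open>N k\<close> sends (u, 0) to a vector with first component
    \<open>adj_app I (M k) u\<close>. Its second component is invisible to inner products with
    vectors (v, 0), so the dilation has the same form on these as the original row.\<close>
  have adj: "adj_app (I <+> I) (N k) (E u) (Inl a) = adj_app I (M k) u a" for k u a
    by (simp add: adj_app_def sum.Plus fin N_def E_def)
  have ip: "ip (I <+> I) (E u) (E v) = ip I u v"
      "ip (I <+> I) (adj_app (I <+> I) (N k) (E u)) (E v) = ip I (adj_app I (M k) u) v"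
      "ip (I <+> I) (E u) (adj_app (I <+> I) (N k) (E v)) = ip I u (adj_app I (M k) v)" for u v k
    by (simp_all add: ip_def sum.Plus fin adj) (simp_all add: E_def)
  show ?thesis
    using coisometric_form_nonneg[of "I <+> I" N J Y c b d "\<lambda>i. E (h i)", OF _ coiso J X] fin
    by (simp only: ip finite_Plus)
qed

lemma cuntz_system_expansion:
  assumes "x \<in> cuntz_system n S"
  shows "x = delta0 n S x *\<^sub>C 1 + (\<Sum>k=1..n. delta n S k x *\<^sub>C S k) + (\<Sum>k=1..n. delta_star n S k x *\<^sub>C star (S k))"
proof -
  note dist = cuntz_basis_distinct[OF n C]
  let ?u = "\<lambda>b. cuntz_delta n S b x"
  have fin: "finite (cuntz_basis n S)" by (simp add: cuntz_basis_def)
  have "x = (\<Sum>b\<in>cuntz_basis n S. ?u b *\<^sub>C b)"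
    using complex_vs.sum_representation_eq[OF cuntz_basis_independent[OF n C] _ fin subset_refl] assms
    by (simp add: cuntz_system_def cuntz_delta_def)
  also have "\<dots> = (\<Sum>v\<in>{1} \<union> S ` {1..n}. ?u v *\<^sub>C v) + (\<Sum>v\<in>(\<lambda>i. star (S i)) ` {1..n}. ?u v *\<^sub>C v)"
    unfolding cuntz_basis_def
    by (rule sum.union_disjoint) (use dist(4,5) in \<open>auto simp del: atLeastAtMost_iff\<close>)
  also have "(\<Sum>v\<in>{1} \<union> S ` {1..n}. ?u v *\<^sub>C v) = ?u 1 *\<^sub>C 1 + (\<Sum>v\<in>S ` {1..n}. ?u v *\<^sub>C v)"
    by (subst sum.union_disjoint) (use dist(3) in \<open>auto simp del: atLeastAtMost_iff\<close>)
  finally show ?thesis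
    using dist(1,2) by (simp add: sum.reindex delta0_def delta_def delta_star_def)
qed

end

section \<open>Quadratic forms of complex matrices\<close>

text \<open>The passage from matrices to forms. The forms are indexed by arbitrary finite sets
  because the dilation lives on the disjoint sum \<open>I <+> I\<close>.\<close>

lemma psd_iff_psd_form: "psd p A \<longleftrightarrow> A \<in> carrier_mat p p \<and> psd_form {..<p} (\<lambda>a b. A $$ (a, b))"
proof -
  have form: "(A *\<^sub>v v) \<bullet>c v = (\<Sum>a<p. \<Sum>b<p. cnj (v $ a) * A $$ (a, b) * v $ b)"
    if "A \<in> carrier_mat p p" "v \<in> carrier_vec p" for v
    using that by (auto simp: scalar_prod_def sum_distrib_left sum_distrib_right lessThan_atLeast0 mult_ac intro!: sum.cong)
  have "(\<forall>v\<in>carrier_vec p. 0 \<le> (\<Sum>a<p. \<Sum>b<p. cnj (v $ a) * A $$ (a, b) * v $ b))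
      \<longleftrightarrow> psd_form {..<p} (\<lambda>a b. A $$ (a, b))" (is "?L \<longleftrightarrow> ?R")
  proof
    assume L: ?L
    show ?R unfolding psd_form_def
    proof
      fix f :: "nat \<Rightarrow> complex"
      show "0 \<le> (\<Sum>a<p. \<Sum>b<p. cnj (f a) * A $$ (a, b) * f b)"
        using bspec[OF L, of "vec p f"] by simp
    qed
  qed (simp add: psd_form_def)
  with form show ?thesis unfolding psd_def by auto
qed

lemma sum_lessThan_mult:
  fixes f :: "nat \<Rightarrow> 'b :: comm_monoid_add"
  shows "(\<Sum>r<m * p. f r) = (\<Sum>i<m. \<Sum>k<p. f (i * p + k))"
proof -
  have "sum f {i * p..<i * p + p} = (\<Sum>k<p. f (i * p + k))" for i
    using sum.shift_bounds_nat_ivl[of f 0 "i * p" p] by (simp add: lessThan_atLeast0 add.commute)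
  then show ?thesis using sum.nat_group[of f p m] by simp
qed

text \<open>A vector of length \<open>m * p\<close> is read as \<open>m\<close> blocks of length
  \<open>p\<close>, with index \<open>i * p + k\<close>; \<open>h i\<close> is the block
  \<open>i\<close>.\<close>

lemma psd_amplify_iff:
  "psd (m * p) (amplify p \<Phi> m X) \<longleftrightarrow> (\<forall>h. 0 \<le> (\<Sum>i<m. \<Sum>j<m. \<Sum>k<p. \<Sum>l<p.
    cnj (h i k) * \<Phi> (X $$ (i, j)) $$ (k, l) * h j l))" (is "_ \<longleftrightarrow> (\<forall>h. 0 \<le> ?Q h)")
proof -
  have form: "(\<Sum>a<m * p. \<Sum>b<m * p. cnj (v a) * amplify p \<Phi> m X $$ (a, b) * v b)
      = ?Q (\<lambda>i k. v (i * p + k))" for v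
  proof -
    have bound: "i * p + k < m * p" if "i < m" "k < p" for i k
    proof -
      have "i * p + k < Suc i * p" using that by simp
      also have "\<dots> \<le> m * p" using that by (intro mult_le_mono1) simp
      finally show ?thesis .
    qed
    have "(\<Sum>a<m * p. \<Sum>b<m * p. cnj (v a) * amplify p \<Phi> m X $$ (a, b) * v b)
      = (\<Sum>i<m. \<Sum>k<p. \<Sum>j<m. \<Sum>l<p. cnj (v (i * p + k)) * \<Phi> (X $$ (i, j)) $$ (k, l) * v (j * p + l))"
      unfolding sum_lessThan_mult by (intro sum.cong refl) (simp add: amplify_def bound)
    also have "\<dots> = ?Q (\<lambda>i k. v (i * p + k))"
      by (rule sum.cong[OF refl], rule sum.swap)
    finally show ?thesis .
  qed
  have Q: "?Q h = ?Q (\<lambda>i k. h ((i * p + k) div p) ((i * p + k) mod p))" for h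
    by (intro sum.cong refl) simp
  have carrier: "amplify p \<Phi> m X \<in> carrier_mat (m * p) (m * p)" by (simp add: amplify_def)
  have "0 \<le> ?Q h" if "\<forall>v. 0 \<le> ?Q (\<lambda>i k. v (i * p + k))" for h
    unfolding Q[of h] using that by (rule allE[where x = "\<lambda>r. h (r div p) (r mod p)"])
  then have "(\<forall>v. 0 \<le> ?Q (\<lambda>i k. v (i * p + k))) \<longleftrightarrow> (\<forall>h. 0 \<le> ?Q h)"
    by (intro iffI allI) (assumption, erule spec)
  with carrier show ?thesis
    unfolding psd_iff_psd_form psd_form_def form by (simp only: simp_thms)
qed

lemma mat_adjoint_carrier: "A \<in> carrier_mat p q \<Longrightarrow> mat_adjoint A \<in> carrier_mat q p"
  unfolding mat_adjoint_def by auto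

lemma mat_adjoint_index:
  "A \<in> carrier_mat p q \<Longrightarrow> k < q \<Longrightarrow> l < p \<Longrightarrow> mat_adjoint A $$ (k, l) = cnj (A $$ (l, k))"
  by (simp add: mat_adjoint_def mat_of_rows_index)

lemma sum_fun_apply: "(\<Sum>i\<in>I. f i) x = (\<Sum>i\<in>I. f i x)"
  by (induction I rule: infinite_finite_induct) simp_all

lemma row_contraction_iff:
  assumes "\<forall>i\<in>{1..n}. A i \<in> carrier_mat p p"
  shows "row_contraction p n A \<longleftrightarrow> psd_form {..<p}
    (\<lambda>a b. (if a = b then 1 else 0) - (\<Sum>k=1..n. \<Sum>c<p. A k $$ (a, c) * cnj (A k $$ (b, c))))"
proof -
  let ?P = "mat_sum p {1..n} (\<lambda>i. A i * mat_adjoint (A i))"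
  have P: "?P \<in> carrier_mat p p" by (simp add: mat_sum_def)
  have adj: "mat_adjoint (A k) \<in> carrier_mat p p" if "k \<in> {1..n}" for k
    using bspec[OF assms that] by (rule mat_adjoint_carrier)
  have entry: "(1\<^sub>m p - ?P) $$ (a, b)
      = (if a = b then 1 else 0) - (\<Sum>k=1..n. \<Sum>c<p. A k $$ (a, c) * cnj (A k $$ (b, c)))"
    if ab: "a < p" "b < p" for a b
  proof -
    have "(A k * mat_adjoint (A k)) $$ (a, b) = (\<Sum>c<p. A k $$ (a, c) * cnj (A k $$ (b, c)))"
      if k: "k \<in> {1..n}" for k
    proof -
      have Ak: "A k \<in> carrier_mat p p" using assms k by blast
      then show ?thesis
        using adj[OF k] ab
        by (auto simp: scalar_prod_def lessThan_atLeast0 mat_adjoint_index[OF Ak] intro!: sum.cong)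
    qed
    then have "(\<Sum>k=1..n. (A k * mat_adjoint (A k)) $$ (a, b))
        = (\<Sum>k=1..n. \<Sum>c<p. A k $$ (a, c) * cnj (A k $$ (b, c)))"
      by (rule sum.cong[OF refl])
    then show ?thesis using ab by (simp only: mat_sum_def index_minus_mat dim_row_mat dim_col_mat
          index_mat index_one_mat split_conv)
  qed
  have "psd_form {..<p} (\<lambda>a b. (1\<^sub>m p - ?P) $$ (a, b)) \<longleftrightarrow> psd_form {..<p}
    (\<lambda>a b. (if a = b then 1 else 0) - (\<Sum>k=1..n. \<Sum>c<p. A k $$ (a, c) * cnj (A k $$ (b, c))))"
    unfolding psd_form_def
    by (intro all_cong1 arg_cong[where f = "\<lambda>x. 0 \<le> x"] sum.cong refl) (simp only: entry lessThan_iff)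
  moreover have "1\<^sub>m p - ?P \<in> carrier_mat p p" using P by (rule minus_carrier_mat)
  ultimately show ?thesis
    using P by (simp only: row_contraction_def loewner_le_def psd_iff_psd_form one_carrier_mat simp_thms)
qed

lemma matrix_cone_entry:
  assumes "Y \<in> carrier_mat m m" "i < m" "j < m"
  shows "(star_mat Y * Y) $$ (i, j) = (\<Sum>r<m. star (Y $$ (r, i)) * Y $$ (r, j))"
  using assms by (auto simp: star_mat_def scalar_prod_def lessThan_atLeast0 intro!: sum.cong)

theorem proposition5p1:
  fixes S :: "nat \<Rightarrow> 'a :: cstar_algebra"
    and A :: "nat \<Rightarrow> complex mat"
    and n p :: nat
  assumes "2 \<le> n"
    and "cuntz_algebra n S"
    and "\<forall>i\<in>{1..n}. A i \<in> carrier_mat p p"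
  shows "(1\<^sub>m p \<otimes>\<^sub>f delta0 n S)
           + mat_sum p {1..n} (\<lambda>i. A i \<otimes>\<^sub>f delta n S i)
           + mat_sum p {1..n} (\<lambda>i. mat_adjoint (A i) \<otimes>\<^sub>f delta_star n S i)
         \<in> dual_matrix_cone (cuntz_system n S) p
         \<longleftrightarrow> row_contraction p n A"
proof -
  let ?V = "cuntz_system n S"
  define F where "F = (1\<^sub>m p \<otimes>\<^sub>f delta0 n S)
           + mat_sum p {1..n} (\<lambda>i. A i \<otimes>\<^sub>f delta n S i)
           + mat_sum p {1..n} (\<lambda>i. mat_adjoint (A i) \<otimes>\<^sub>f delta_star n S i)"
  define \<Phi> where "\<Phi> x = map_mat (\<lambda>f. f x) F" for x
  define M where "M k a b = A k $$ (a, b)" for k a b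
  let ?I = "{..<p}"
  let ?adj = "\<lambda>k. adj_app ?I (M k)"
  \<comment> \<open>This is \<open><h, \<Phi> x g>\<close> written in the coordinates of
    \<open>x\<close>, the shape in which \<open>contraction_form_nonneg\<close> delivers its
    conclusion.\<close>
  define R where "R x h g = delta0 n S x * ip ?I h g
    + (\<Sum>k=1..n. delta n S k x * ip ?I (?adj k h) g + delta_star n S k x * ip ?I h (?adj k g))" for x h g
  have dual: "x \<in> ?V \<Longrightarrow> y \<in> ?V \<Longrightarrow> cuntz_delta n S b (x + y) = cuntz_delta n S b x + cuntz_delta n S b y"
    "x \<in> ?V \<Longrightarrow> cuntz_delta n S b (c *\<^sub>C x) = c * cuntz_delta n S b x"
    "x \<notin> ?V \<Longrightarrow> cuntz_delta n S b x = 0" for b c x y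
    using cuntz_delta_dual[OF assms(1,2), of b] unfolding dual_space_def by blast+
  have FC: "F \<in> carrier_mat p p" by (simp add: F_def mat_sum_def tensor_def)
  have F: "(F $$ (k, l)) x = (if k = l then 1 else 0) * delta0 n S x
      + (\<Sum>i=1..n. M i k l * delta n S i x) + (\<Sum>i=1..n. cnj (M i l k) * delta_star n S i x)"
    if kl: "k < p" "l < p" for k l x
  proof -
    have "((A i \<otimes>\<^sub>f delta n S i) $$ (k, l)) x = M i k l * delta n S i x"
      "((mat_adjoint (A i) \<otimes>\<^sub>f delta_star n S i) $$ (k, l)) x = cnj (M i l k) * delta_star n S i x"
      if i: "i \<in> {1..n}" for i
    proof -
      have "A i \<in> carrier_mat p p" using assms(3) i by blast
      then show "((A i \<otimes>\<^sub>f delta n S i) $$ (k, l)) x = M i k l * delta n S i x"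
        "((mat_adjoint (A i) \<otimes>\<^sub>f delta_star n S i) $$ (k, l)) x = cnj (M i l k) * delta_star n S i x"
        using kl mat_adjoint_index[of "A i" p p k l] mat_adjoint_carrier[of "A i" p p]
        by (simp_all add: tensor_def M_def)
    qed
    then show ?thesis using kl
      by (simp add: F_def mat_sum_def sum_fun_apply del: atLeastAtMost_iff) (simp add: tensor_def)
  qed
  have \<Phi>C: "\<Phi> x \<in> carrier_mat p p" for x using FC by (simp add: \<Phi>_def)
  have \<Phi>: "\<Phi> x $$ (k, l) = (F $$ (k, l)) x" if "k < p" "l < p" for k l x
    using that FC by (simp add: \<Phi>_def)
  have F_dual: "F $$ (k, l) \<in> dual_space ?V" if "k < p" "l < p" for k l
    unfolding dual_space_def
    by (simp add: F[OF that] delta0_def delta_def delta_star_def dual distrib_left sum.distrib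
        sum_distrib_left mult.left_commute del: mult_eq_0_iff)
  \<comment> \<open>The linearity clauses of complete positivity follow from the entries of
    \<open>F\<close> being functionals, so only the positivity clause remains.\<close>
  have cp: "F \<in> dual_matrix_cone ?V p
      \<longleftrightarrow> (\<forall>m. \<forall>X\<in>matrix_cone ?V m. psd (m * p) (amplify p \<Phi> m X))"
  proof -
    have "\<Phi> (x + y) = \<Phi> x + \<Phi> y" if "x \<in> ?V" "y \<in> ?V" for x y
      using F_dual that FC \<Phi>C[of x] \<Phi>C[of y] \<Phi>C[of "x + y"]
      by (intro eq_matI) (auto simp: \<Phi> dual_space_def)
    moreover have "\<Phi> (c *\<^sub>C x) = c \<cdot>\<^sub>m \<Phi> x" if "x \<in> ?V" for c x
      using F_dual that FC \<Phi>C[of x] \<Phi>C[of "c *\<^sub>C x"]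
      by (intro eq_matI) (auto simp: \<Phi> dual_space_def)
    ultimately have "completely_positive ?V p \<Phi>
        \<longleftrightarrow> (\<forall>m. \<forall>X\<in>matrix_cone ?V m. psd (m * p) (amplify p \<Phi> m X))"
      using \<Phi>C by (simp add: completely_positive_def)
    moreover have "(\<lambda>x. map_mat (\<lambda>f. f x) F) = \<Phi>" by (simp add: \<Phi>_def fun_eq_iff)
    ultimately show ?thesis using FC F_dual by (simp add: dual_matrix_cone_def)
  qed
  have R: "(\<Sum>k<p. \<Sum>l<p. cnj (h k) * \<Phi> x $$ (k, l) * g l) = R x h g" for x h g
  proof -
    have 1: "(\<Sum>k<p. \<Sum>l<p. cnj (h k) * (if k = l then 1 else 0) * g l) = ip ?I h g"
      by (simp add: ip_def if_distrib[of "\<lambda>x. _ * x * _"] cong: if_cong)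
    have 2: "(\<Sum>k<p. \<Sum>l<p. cnj (h k) * M i k l * g l) = ip ?I (?adj i h) g" for i
      by (subst sum.swap) (simp add: ip_def adj_app_def sum_distrib_left sum_distrib_right mult_ac)
    have 3: "(\<Sum>k<p. \<Sum>l<p. cnj (h k) * cnj (M i l k) * g l) = ip ?I h (?adj i g)" for i
      by (simp add: ip_def adj_app_def sum_distrib_left mult_ac)
    have "(\<Sum>k<p. \<Sum>l<p. cnj (h k) * \<Phi> x $$ (k, l) * g l)
      = (\<Sum>k<p. \<Sum>l<p. delta0 n S x * (cnj (h k) * (if k = l then 1 else 0) * g l)
         + (\<Sum>i=1..n. delta n S i x * (cnj (h k) * M i k l * g l)
             + delta_star n S i x * (cnj (h k) * cnj (M i l k) * g l)))"
      by (intro sum.cong refl)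
        (simp add: \<Phi> F distrib_left distrib_right sum_distrib_left sum_distrib_right sum.distrib mult_ac)
    also have "\<dots> = delta0 n S x * (\<Sum>k<p. \<Sum>l<p. cnj (h k) * (if k = l then 1 else 0) * g l)
         + (\<Sum>i=1..n. \<Sum>k<p. \<Sum>l<p. delta n S i x * (cnj (h k) * M i k l * g l)
             + delta_star n S i x * (cnj (h k) * cnj (M i l k) * g l))"
      by (simp only: sum.distrib sum_distrib_left sum.swap[of _ "{1..n}"])
    also have "\<dots> = R x h g"
      by (simp only: sum.distrib sum_distrib_left[symmetric] 1 2 3 R_def)
    finally show ?thesis .
  qed
  have psd: "psd (m * p) (amplify p \<Phi> m X) \<longleftrightarrow> (\<forall>h. 0 \<le> (\<Sum>i<m. \<Sum>j<m. R (X $$ (i, j)) (h i) (h j)))"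
    for m X unfolding psd_amplify_iff R ..
  have contr: "row_contraction p n A \<longleftrightarrow> psd_form ?I
      (\<lambda>a b. (if a = b then 1 else 0) - (\<Sum>k=1..n. \<Sum>c\<in>?I. M k a c * cnj (M k b c)))"
    unfolding row_contraction_iff[OF assms(3)] M_def ..
  have "row_contraction p n A" if pos: "\<forall>m. \<forall>X\<in>matrix_cone ?V m. psd (m * p) (amplify p \<Phi> m X)"
    unfolding contr psd_form_def
  proof
    fix u :: "nat \<Rightarrow> complex"
    note rel = cuntz_star_mult[OF assms(1,2)]
    define E where "E i = (if i = 0 then 1 else S i)" for i
    define X where "X = mat (Suc n) (Suc n) (\<lambda>(i, j). star (E i) * E j)"
    \<comment> \<open>The row \<open>E\<close>, padded with zero rows because
      \<open>matrix_cone\<close> asks for a square factor.\<close>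
    define Y where "Y = mat (Suc n) (Suc n) (\<lambda>(i, j). if i = 0 then E j else 0)"
    \<comment> \<open>The map sends \<open>X\<close> to the block matrix with identity diagonal,
      first row (I, A_1, ..., A_n) and first column its adjoint. The blocks
      \<open>- ?adj j u\<close> minimise its form for a given first block \<open>u\<close>, and the
      minimum is the Schur complement \<open>I - \<Sum> A_k A_k^*\<close> at
      \<open>u\<close>.\<close>
    define h where "h j = (if j = 0 then u else (\<lambda>a. - ?adj j u a))" for j
    note vals = dual_basis_values[OF assms(1,2)]
    have one: "1 \<in> {1..n}" using assms(1) by simp
    have R1: "R 1 v w = ip ?I v w" for v w
      using vals(1)[OF one one] vals(4,7)[OF _ one] by (simp add: R_def del: atLeastAtMost_iff)
    have R0: "R 0 v w = 0" for v w
      by (simp add: R_def delta0_def delta_def delta_star_def cuntz_delta_def complex_vs.representation_zero)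
    have RS: "R (S j) v w = ip ?I (?adj j v) w" if j: "j \<in> {1..n}" for j v w
      using vals(2)[OF one j] vals(5,8)[OF _ j] j
      by (simp add: R_def if_distrib[of "\<lambda>x. x * _"] del: atLeastAtMost_iff cong: if_cong)
    have RS': "R (star (S j)) v w = ip ?I v (?adj j w)" if j: "j \<in> {1..n}" for j v w
      using vals(3)[OF one j] vals(6,9)[OF _ j] j
      by (simp add: R_def if_distrib[of "\<lambda>x. x * _"] del: atLeastAtMost_iff cong: if_cong)
    have neg: "ip ?I (\<lambda>a. - v a) w = - ip ?I v w" "ip ?I w (\<lambda>a. - v a) = - ip ?I w v" for v w
      by (simp_all add: ip_def sum_negf)
    have h: "h j = (\<lambda>a. - ?adj j u a)" if "j \<in> {1..n}" for j using that by (simp add: h_def)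
    let ?q = "\<lambda>k. ip ?I (?adj k u) (?adj k u)"
    have V: "1 \<in> ?V" "0 \<in> ?V" "k \<in> {1..n} \<Longrightarrow> S k \<in> ?V" "k \<in> {1..n} \<Longrightarrow> star (S k) \<in> ?V" for k
      by (auto simp: cuntz_system_def cuntz_basis_def complex_vs.span_zero intro!: complex_vs.span_base)
    have "X = star_mat Y * Y"
    proof (rule eq_matI)
      fix i j assume "i < dim_row (star_mat Y * Y)" "j < dim_col (star_mat Y * Y)"
      then have ij: "i < Suc n" "j < Suc n" by (simp_all add: Y_def star_mat_def)
      have "(star_mat Y * Y) $$ (i, j) = (\<Sum>r<Suc n. star (Y $$ (r, i)) * Y $$ (r, j))"
        using ij by (intro matrix_cone_entry) (simp_all add: Y_def)
      also have "\<dots> = (\<Sum>r<Suc n. if r = 0 then star (E i) * E j else 0)"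
        using ij by (intro sum.cong refl) (simp add: Y_def)
      finally show "X $$ (i, j) = (star_mat Y * Y) $$ (i, j)"
        using ij by (simp add: X_def del: sum.lessThan_Suc)
    qed (simp_all add: X_def Y_def star_mat_def)
    moreover have "Y \<in> carrier_mat (Suc n) (Suc n)" by (simp add: Y_def)
    moreover have "X \<in> carrier_mat (Suc n) (Suc n)" by (simp add: X_def)
    \<comment> \<open>The products \<open>star (S i) * S j\<close> are 0 or 1, which keeps
      \<open>X\<close> inside the operator system although that is not closed under
      multiplication.\<close>
    moreover have "X $$ (i, j) \<in> ?V" if "i < Suc n" "j < Suc n" for i j
    proof -
      have "i \<in> {1..n}" if "i \<noteq> 0" using that \<open>i < Suc n\<close> by simp
      moreover have "j \<in> {1..n}" if "j \<noteq> 0" using that \<open>j < Suc n\<close> by simp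
      ultimately show ?thesis using \<open>i < Suc n\<close> \<open>j < Suc n\<close>
        by (simp add: X_def E_def V rel del: atLeastAtMost_iff)
    qed
    ultimately have "X \<in> matrix_cone ?V (Suc n)"
      unfolding matrix_cone_def by blast
    then have "0 \<le> (\<Sum>i<Suc n. \<Sum>j<Suc n. R (X $$ (i, j)) (h i) (h j))"
      using pos psd by blast
    also have "\<dots> = (\<Sum>i<Suc n. \<Sum>j<Suc n. R (star (E i) * E j) (h i) (h j))"
      by (intro sum.cong refl) (simp add: X_def)
    also have "{..<Suc n} = insert 0 {1..n}" by auto
    also have "(\<Sum>i\<in>insert 0 {1..n}. \<Sum>j\<in>insert 0 {1..n}. R (star (E i) * E j) (h i) (h j))
        = R 1 u u + (\<Sum>j=1..n. R (S j) u (h j)) + (\<Sum>i=1..n. R (star (S i)) (h i) u)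
          + (\<Sum>i=1..n. \<Sum>j=1..n. R (if i = j then 1 else 0) (h i) (h j))"
      by (simp add: E_def h_def rel sum.distrib)
    also have "R 1 u u = ip ?I u u" by (rule R1)
    also have "(\<Sum>j=1..n. R (S j) u (h j)) = - (\<Sum>k=1..n. ?q k)"
      by (simp add: RS RS' h neg sum_negf del: atLeastAtMost_iff)
    also have "(\<Sum>i=1..n. R (star (S i)) (h i) u) = - (\<Sum>k=1..n. ?q k)"
      by (simp add: RS RS' h neg sum_negf del: atLeastAtMost_iff)
    also have "(\<Sum>i=1..n. \<Sum>j=1..n. R (if i = j then 1 else 0) (h i) (h j)) = (\<Sum>k=1..n. ?q k)"
      by (simp add: if_distrib[of "\<lambda>x. R x _ _"] R0 R1 h neg del: atLeastAtMost_iff cong: if_cong)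
    also have "ip ?I u u + - (\<Sum>k=1..n. ?q k) + - (\<Sum>k=1..n. ?q k) + (\<Sum>k=1..n. ?q k)
        = ip ?I u u - (\<Sum>k=1..n. ?q k)" by simp
    also have "\<dots> = (\<Sum>a\<in>?I. \<Sum>b\<in>?I. cnj (u a) * ((if a = b then 1 else 0)
        - (\<Sum>k=1..n. \<Sum>c\<in>?I. M k a c * cnj (M k b c))) * u b)"
    proof -
      have "ip ?I u u = (\<Sum>a\<in>?I. \<Sum>b\<in>?I. cnj (u a) * (if a = b then 1 else 0) * u b)"
        by (simp add: ip_def if_distrib[of "\<lambda>x. _ * x * _"] cong: if_cong)
      then show ?thesis
        unfolding sum_ip_adj_app by (simp only: right_diff_distrib left_diff_distrib sum_subtractf)
    qed
    finally show "0 \<le> (\<Sum>a\<in>?I. \<Sum>b\<in>?I. cnj (u a) * ((if a = b then 1 else 0)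
        - (\<Sum>k=1..n. \<Sum>c\<in>?I. M k a c * cnj (M k b c))) * u b)" .
  qed
  moreover have "psd (m * p) (amplify p \<Phi> m X)"
    if rc: "row_contraction p n A" and X: "X \<in> matrix_cone ?V m" for m X
    unfolding psd
  proof
    fix h
    obtain Y where Y: "Y \<in> carrier_mat m m" "X = star_mat Y * Y" using X by (auto simp: matrix_cone_def)
    \<comment> \<open>Although the entries of \<open>Y\<close> may lie outside the operator system,
      each entry of \<open>star_mat Y * Y\<close> lies in it and so has coordinates in the
      basis.\<close>
    have "(\<Sum>r<m. star (Y $$ (r, i)) * Y $$ (r, j))
        = delta0 n S (X $$ (i, j)) *\<^sub>C 1 + (\<Sum>k=1..n. delta n S k (X $$ (i, j)) *\<^sub>C S k)
          + (\<Sum>k=1..n. delta_star n S k (X $$ (i, j)) *\<^sub>C star (S k))" if "i \<in> {..<m}" "j \<in> {..<m}" for i j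
    proof -
      have "X $$ (i, j) \<in> ?V" using X that by (simp add: matrix_cone_def)
      from cuntz_system_expansion[OF assms(1,2) this] show ?thesis
        using matrix_cone_entry[OF Y(1), of i j] that Y(2) by simp
    qed
    from contraction_form_nonneg[OF assms(1,2) finite_lessThan rc[unfolded contr] finite_lessThan this]
    show "0 \<le> (\<Sum>i<m. \<Sum>j<m. R (X $$ (i, j)) (h i) (h j))" unfolding R_def .
  qed
  ultimately show ?thesis unfolding F_def[symmetric] cp by blast
qed

end
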